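(* For the locally free group on $n$ generators, with the simple random walk, the logarithmic volume $v$, the drift $l$ and the entropy $h$ satisfy, for all sufficiently large $n$, the strict inequality $$v\,l>h.$$
   Context: The locally free group on $n$ generators is the group with generators $f_1,\dots,f_n$ and defining relations $f_jf_k=f_kf_j$ for $|j-k|\ge 2$. The length of an element is the minimal length of a word in $f_1^{\pm1},\dots,f_n^{\pm1}$ representing it. The logarithmic volume is $v=\lim_{K\to\infty}\frac{\log V(K)}{K}$, where $V(K)$ is the number of elements of length $K$. The simple random walk starts at the identity and at each step multiplies on the right by an element of $\{f_1^{\pm1},\dots,f_n^{\pm1}\}$ chosen uniformly (probability $\frac1{2n}$ each) and independently. The drift is $l=\limsup_{N\to\infty}\frac{L(N)}{N}$, where $L(N)$ is the expected length of the position after $N$ steps. The entropy is $h=\lim_{N\to\infty}\frac{H(\mu^N)}{N}$, where $\mu^N$ is the law of the position after $N$ steps and $H(\nu)=-\sum_{x\in\operatorname{supp}\nu}\nu(x)\log\nu(x)$. *)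

theory Defs
  imports "HOL-Algebra.Group" "HOL-Probability.Probability"
begin

text \<open>A letter \<open>(x, True)\<close> stands for the generator \<open>x\<close>, and \<open>(x, False)\<close> for its formal inverse.\<close>

type_synonym 'a letter = "'a \<times> bool"

fun inv_letter :: "'a letter \<Rightarrow> 'a letter" where
  "inv_letter (x, b) = (x, \<not> b)"

definition words :: "'a set \<Rightarrow> 'a letter list set" where
  "words X = lists (X \<times> UNIV)"

text \<open>The congruence on words generated by free cancellation and by a set \<open>R\<close> of defining
  relations, a pair \<open>(r, s)\<close> meaning \<open>r = s\<close>. The words modulo this congruence form the group
  presented by \<open>X\<close> and \<open>R\<close>.\<close>

inductive word_cong :: "'a set \<Rightarrow> ('a letter list \<times> 'a letter list) set
    \<Rightarrow> 'a letter list \<Rightarrow> 'a letter list \<Rightarrow> bool" for X R where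
  refl: "w \<in> words X \<Longrightarrow> word_cong X R w w"
| sym: "word_cong X R u v \<Longrightarrow> word_cong X R v u"
| trans: "word_cong X R u v \<Longrightarrow> word_cong X R v w \<Longrightarrow> word_cong X R u w"
| cancel: "u \<in> words X \<Longrightarrow> v \<in> words X \<Longrightarrow> a \<in> X \<times> UNIV
    \<Longrightarrow> word_cong X R (u @ [a, inv_letter a] @ v) (u @ v)"
| relation: "u \<in> words X \<Longrightarrow> v \<in> words X \<Longrightarrow> (r, s) \<in> R \<Longrightarrow> r \<in> words X \<Longrightarrow> s \<in> words X
    \<Longrightarrow> word_cong X R (u @ r @ v) (u @ s @ v)"

definition word_class :: "'a set \<Rightarrow> ('a letter list \<times> 'a letter list) set
    \<Rightarrow> 'a letter list \<Rightarrow> 'a letter list set" where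
  "word_class X R w = {v. word_cong X R w v}"

definition presented_group :: "'a set \<Rightarrow> ('a letter list \<times> 'a letter list) set
    \<Rightarrow> 'a letter list set monoid" where
  "presented_group X R =
    \<lparr> carrier = word_class X R ` words X,
      monoid.mult = (\<lambda>A B. \<Union>a\<in>A. \<Union>b\<in>B. word_class X R (a @ b)),
      monoid.one = word_class X R [] \<rparr>"

lemma words_simps [simp]:
  "[] \<in> words X"
  "a # w \<in> words X \<longleftrightarrow> fst a \<in> X \<and> w \<in> words X"
  "u @ v \<in> words X \<longleftrightarrow> u \<in> words X \<and> v \<in> words X"
  by (auto simp: words_def mem_Times_iff)

lemma word_cong_words:
  "word_cong X R u v \<Longrightarrow> u \<in> words X \<and> v \<in> words X"
  by (induction rule: word_cong.induct) auto

lemma word_cong_append_left: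
  "word_cong X R u v \<Longrightarrow> w \<in> words X \<Longrightarrow> word_cong X R (w @ u) (w @ v)"
proof (induction rule: word_cong.induct)
  case (refl u)
  then show ?case by (simp add: word_cong.refl)
next
  case (sym u v)
  then show ?case by (simp add: word_cong.sym)
next
  case (trans u v x)
  then show ?case by (meson word_cong.trans)
next
  case (cancel u v a)
  then show ?case using word_cong.cancel[of "w @ u" X v a R] by simp
next
  case (relation u v r s)
  then show ?case using word_cong.relation[of "w @ u" X v r s R] by simp
qed

lemma word_cong_append_right:
  "word_cong X R u v \<Longrightarrow> w \<in> words X \<Longrightarrow> word_cong X R (u @ w) (v @ w)"
proof (induction rule: word_cong.induct)
  case (refl u)
  then show ?case by (simp add: word_cong.refl)
next
  case (sym u v)
  then show ?case by (simp add: word_cong.sym)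
next
  case (trans u v x)
  then show ?case by (meson word_cong.trans)
next
  case (cancel u v a)
  then show ?case using word_cong.cancel[of u X "v @ w" a R] by simp
next
  case (relation u v r s)
  then show ?case using word_cong.relation[of u X "v @ w" r s R] by simp
qed

lemma word_cong_append:
  "word_cong X R u u' \<Longrightarrow> word_cong X R v v' \<Longrightarrow> word_cong X R (u @ v) (u' @ v')"
  by (meson word_cong.trans word_cong_append_left word_cong_append_right word_cong_words)

lemma word_class_eq_iff:
  assumes "u \<in> words X"
  shows "word_class X R u = word_class X R v \<longleftrightarrow> word_cong X R u v"
proof
  assume "word_class X R u = word_class X R v"
  moreover have "u \<in> word_class X R u"
    using assms by (simp add: word_class_def word_cong.refl)
  ultimately show "word_cong X R u v"
    by (simp add: word_class_def word_cong.sym)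
next
  assume uv: "word_cong X R u v"
  then have "word_cong X R u w \<longleftrightarrow> word_cong X R v w" for w
    by (meson word_cong.sym word_cong.trans)
  then show "word_class X R u = word_class X R v"
    by (simp add: word_class_def)
qed

lemma presented_group_mult:
  assumes "u \<in> words X" "v \<in> words X"
  shows "word_class X R u \<otimes>\<^bsub>presented_group X R\<^esub> word_class X R v = word_class X R (u @ v)"
proof -
  have eq: "word_class X R (a @ b) = word_class X R (u @ v)"
    if "a \<in> word_class X R u" "b \<in> word_class X R v" for a b
  proof -
    have "word_cong X R (u @ v) (a @ b)"
      using that by (simp add: word_class_def word_cong_append)
    then show ?thesis
      using assms word_class_eq_iff[of "u @ v" X R "a @ b"] by simp
  qed
  have ne: "u \<in> word_class X R u" "v \<in> word_class X R v"
    using assms by (simp_all add: word_class_def word_cong.refl)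
  have "(\<Union>a\<in>word_class X R u. \<Union>b\<in>word_class X R v. word_class X R (a @ b))
      = (\<Union>a\<in>word_class X R u. \<Union>b\<in>word_class X R v. word_class X R (u @ v))"
    by (intro SUP_cong HOL.refl eq)
  also have "\<dots> = word_class X R (u @ v)"
    using ne by blast
  finally show ?thesis
    by (simp add: presented_group_def)
qed

lemma word_cong_inverse:
  "w \<in> words X \<Longrightarrow> word_cong X R (rev (map inv_letter w) @ w) []
    \<and> rev (map inv_letter w) \<in> words X"
proof (induction w)
  case Nil
  then show ?case by (auto intro: word_cong.refl)
next
  case (Cons a w)
  let ?i = "rev (map inv_letter w)"
  have a: "inv_letter a \<in> X \<times> UNIV" "inv_letter (inv_letter a) = a"
    using Cons.prems by (cases a; auto)+
  have w: "w \<in> words X" using Cons.prems by simp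
  have "word_cong X R (?i @ [inv_letter a, a] @ w) (?i @ w)"
    using word_cong.cancel[of ?i X w "inv_letter a" R] Cons.IH w a by simp
  moreover have "word_cong X R (?i @ w) []" "?i \<in> words X"
    using Cons.IH w by auto
  ultimately have "word_cong X R (?i @ [inv_letter a, a] @ w) []"
    by (meson word_cong.trans)
  then show ?case
    using \<open>?i \<in> words X\<close> a by auto
qed

lemma group_presented_group: "group (presented_group X R)"
proof (rule groupI)
  fix A B assume "A \<in> carrier (presented_group X R)" "B \<in> carrier (presented_group X R)"
  then obtain a b where "A = word_class X R a" "B = word_class X R b"
    "a \<in> words X" "b \<in> words X"
    by (auto simp: presented_group_def)
  then show "A \<otimes>\<^bsub>presented_group X R\<^esub> B \<in> carrier (presented_group X R)"
    by (simp add: presented_group_mult) (simp add: presented_group_def)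
next
  show "\<one>\<^bsub>presented_group X R\<^esub> \<in> carrier (presented_group X R)"
    by (auto simp: presented_group_def)
next
  fix A B C assume "A \<in> carrier (presented_group X R)" "B \<in> carrier (presented_group X R)"
    "C \<in> carrier (presented_group X R)"
  then obtain a b c where "A = word_class X R a" "B = word_class X R b" "C = word_class X R c"
    "a \<in> words X" "b \<in> words X" "c \<in> words X"
    by (auto simp: presented_group_def)
  then show "A \<otimes>\<^bsub>presented_group X R\<^esub> B \<otimes>\<^bsub>presented_group X R\<^esub> C
      = A \<otimes>\<^bsub>presented_group X R\<^esub> (B \<otimes>\<^bsub>presented_group X R\<^esub> C)"
    by (simp add: presented_group_mult)
next
  fix A assume "A \<in> carrier (presented_group X R)"
  then obtain a where a: "A = word_class X R a" "a \<in> words X"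
    by (auto simp: presented_group_def)
  have one: "\<one>\<^bsub>presented_group X R\<^esub> = word_class X R []"
    by (simp add: presented_group_def)
  show "\<one>\<^bsub>presented_group X R\<^esub> \<otimes>\<^bsub>presented_group X R\<^esub> A = A"
    unfolding one using a by (simp add: presented_group_mult)
  let ?i = "rev (map inv_letter a)"
  have i: "word_cong X R (?i @ a) []" "?i \<in> words X"
    using word_cong_inverse[OF a(2)] by auto
  have "word_class X R ?i \<otimes>\<^bsub>presented_group X R\<^esub> A = \<one>\<^bsub>presented_group X R\<^esub>"
    unfolding one using a i by (simp add: presented_group_mult word_class_eq_iff)
  moreover have "word_class X R ?i \<in> carrier (presented_group X R)"
    using i(2) by (auto simp: presented_group_def)
  ultimately show "\<exists>B\<in>carrier (presented_group X R).
      B \<otimes>\<^bsub>presented_group X R\<^esub> A = \<one>\<^bsub>presented_group X R\<^esub>" by blast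
qed

definition locally_free_relations :: "nat \<Rightarrow> (nat letter list \<times> nat letter list) set" where
  "locally_free_relations n =
    {([(j, True), (k, True)], [(k, True), (j, True)]) | j k.
       j \<in> {1..n} \<and> k \<in> {1..n} \<and> \<bar>int j - int k\<bar> \<ge> 2}"

definition locally_free_group :: "nat \<Rightarrow> nat letter list set monoid" where
  "locally_free_group n = presented_group {1..n} (locally_free_relations n)"

abbreviation lf_elem :: "nat \<Rightarrow> nat letter list \<Rightarrow> nat letter list set" where
  "lf_elem n w \<equiv> word_class {1..n} (locally_free_relations n) w"

definition lf_length :: "nat \<Rightarrow> nat letter list set \<Rightarrow> nat" where
  "lf_length n g = (LEAST k. \<exists>w\<in>words {1..n}. lf_elem n w = g \<and> length w = k)"

definition sphere_size :: "nat \<Rightarrow> nat \<Rightarrow> nat" where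
  "sphere_size n K = card {g \<in> carrier (locally_free_group n). lf_length n g = K}"

definition log_volume :: "nat \<Rightarrow> real" where
  "log_volume n = lim (\<lambda>K. ln (real (sphere_size n K)) / real K)"

definition step_law :: "nat \<Rightarrow> nat letter list set pmf" where
  "step_law n = map_pmf (\<lambda>a. lf_elem n [a]) (pmf_of_set ({1..n} \<times> UNIV))"

primrec walk_law :: "nat \<Rightarrow> nat \<Rightarrow> nat letter list set pmf" where
  "walk_law n 0 = return_pmf \<one>\<^bsub>locally_free_group n\<^esub>"
| "walk_law n (Suc N) =
    bind_pmf (walk_law n N) (\<lambda>g. map_pmf (\<lambda>s. g \<otimes>\<^bsub>locally_free_group n\<^esub> s) (step_law n))"

definition expected_length :: "nat \<Rightarrow> nat \<Rightarrow> real" where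
  "expected_length n N = measure_pmf.expectation (walk_law n N) (\<lambda>g. real (lf_length n g))"

text \<open>The upper limit is taken in the extended reals. It is finite, as \<open>0 \<le> expected_length n N \<le> N\<close>.\<close>

definition drift :: "nat \<Rightarrow> real" where
  "drift n = real_of_ereal (limsup (\<lambda>N. ereal (expected_length n N / real N)))"

text \<open>Only meant for laws of finite support, such as those of the walk.\<close>

definition shannon_entropy :: "'a pmf \<Rightarrow> real" where
  "shannon_entropy p = - (\<Sum>x\<in>set_pmf p. pmf p x * ln (pmf p x))"

definition walk_entropy :: "nat \<Rightarrow> real" where
  "walk_entropy n = lim (\<lambda>N. shannon_entropy (walk_law n N) / real N)"

end

theory Submission
  imports Defs "HOL-Real_Asymp.Real_Asymp"
begin

text \<open>
  Elements that are typical for the volume avoid the boundary columns: in most elements of length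
  \<open>K\<close> the generator \<open>f\<^sub>1\<close> occurs only \<open>O(K / n\<^sup>3)\<close> times, whereas the random walk
  produces it at the linear rate \<open>c / n\<close>. Quantitatively, give an element the weight
  \<open>7 powr -length * (7 / 3) powr m\<close>, where \<open>m\<close> is the number of occurrences of \<open>f\<^sub>1\<close>; the bonus
  \<open>7 / 3\<close> is for free, as the weights still sum to at most \<open>2 ^ n\<close>. Gibbs' inequality then gives
  \<open>h \<le> l * ln 7 - c * ln (7 / 3) / n\<close> with \<open>c = 2 / 5\<close>, which beats the volume deficit
  \<open>ln 7 - v = O(1 / n\<^sup>2)\<close>.

  Both estimates on sums over group elements come from one recurrence. Let \<open>F m\<close> be the weighted sum
  over the elements none of whose removable last letters lies in a column below \<open>m\<close>. Pushing a
  letter in column \<open>m\<close> shows \<open>F (m + 1) = F m - x * F (m - 1)\<close> with \<open>x = 2 * t / (1 + t)\<close>, where \<open>t\<close>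
  is the weight of a letter in that column, and \<open>F (n + 1) = 1\<close>. For \<open>x = 1 / 4\<close> the ratios stay
  above \<open>1 / 2\<close>, which bounds \<open>F 0\<close>; for \<open>x = 1 / (4 * cos \<theta> ^ 2)\<close>, \<open>\<theta> = pi / (n + 1)\<close>, no positive
  solution exists, so the growth series diverges at \<open>t\<close> and \<open>v \<ge> - ln t\<close>.
\<close>

declare One_nat_def [simp del]

subsection \<open>Pilings\<close>

type_synonym piling = "nat \<Rightarrow> bool option list"

definition near :: "nat \<Rightarrow> nat \<Rightarrow> bool" where
  "near i j \<longleftrightarrow> i = Suc j \<or> j = Suc i"

text \<open>An element is encoded by a piling: a letter puts its sign on its own column and a blank
  \<open>None\<close> on the two neighbouring columns, so that commuting letters act on the piling in either
  order with the same result.\<close>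

definition push :: "nat letter \<Rightarrow> piling \<Rightarrow> piling" where
  "push a p = (\<lambda>j. if j = fst a then Some (snd a) # p j
    else if near (fst a) j then None # p j else p j)"

text \<open>Inverts \<open>push\<close> only where column \<open>i\<close> has a sign on top; in a
  piling the neighbours of such a column have blanks on top.\<close>

definition pop :: "nat \<Rightarrow> piling \<Rightarrow> piling" where
  "pop i p = (\<lambda>j. if j = i \<or> near i j then tl (p j) else p j)"

text \<open>\<open>None\<close> stands both for an empty column and for one covered by a blank.
  \<open>Some e\<close> marks a letter that commutes to the end of the word.\<close>

definition top_sign :: "piling \<Rightarrow> nat \<Rightarrow> bool option" where
  "top_sign p i = (case p i of [] \<Rightarrow> None | s # _ \<Rightarrow> s)"

text \<open>Models right multiplication by \<open>a\<close>; the first branch is a cancellation with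
  a visible inverse letter.\<close>

definition act :: "nat letter \<Rightarrow> piling \<Rightarrow> piling" where
  "act a p = (if top_sign p (fst a) = Some (\<not> snd a) then pop (fst a) p else push a p)"

definition piling_of :: "nat letter list \<Rightarrow> piling" where
  "piling_of w = fold act w (\<lambda>_. [])"

text \<open>Words read without any cancellation, together with their piling; they turn out to be
  geodesic.\<close>

inductive normal_word :: "nat \<Rightarrow> nat letter list \<Rightarrow> piling \<Rightarrow> bool" for n where
  Nil: "normal_word n [] (\<lambda>_. [])"
| snoc: "normal_word n w p \<Longrightarrow> fst a \<in> {1..n} \<Longrightarrow> top_sign p (fst a) \<noteq> Some (\<not> snd a)
    \<Longrightarrow> normal_word n (w @ [a]) (push a p)"

definition pilings :: "nat \<Rightarrow> piling set" where
  "pilings n = {p. \<exists>w. normal_word n w p}"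

abbreviation lf_cong :: "nat \<Rightarrow> nat letter list \<Rightarrow> nat letter list \<Rightarrow> bool" where
  "lf_cong n \<equiv> word_cong {1..n} (locally_free_relations n)"

lemma near_commute: "near i j \<longleftrightarrow> near j i"
  by (auto simp: near_def)

lemma not_near_self [simp]: "\<not> near i i"
  by (simp add: near_def)

lemma top_sign_push:
  "top_sign (push a p) j = (if j = fst a then Some (snd a)
     else if near (fst a) j then None else top_sign p j)"
  by (simp add: top_sign_def push_def)

lemma pop_push [simp]: "pop (fst a) (push a p) = p"
  by (auto simp: pop_def push_def)

lemma push_eq_iff: "push a p = push a q \<longleftrightarrow> p = q"
  by (metis pop_push)

lemma push_push_commute:
  assumes "fst a \<noteq> fst b" "\<not> near (fst a) (fst b)"
  shows "push a (push b p) = push b (push a p)"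
  using assms by (auto simp: push_def near_commute)

section \<open>Commutation of letters in the group\<close>

lemma lf_cong_refl: "w \<in> words {1..n} \<Longrightarrow> lf_cong n w w"
  by (rule word_cong.refl)

lemma lf_cong_cancel: "fst a \<in> {1..n} \<Longrightarrow> lf_cong n [a, inv_letter a] []"
  using word_cong.cancel[of "[]" "{1..n}" "[]" a] by (cases a) auto

lemma inv_letter_inv_letter [simp]: "inv_letter (inv_letter a) = a"
  by (cases a) auto

lemma fst_inv_letter [simp]: "fst (inv_letter a) = fst a"
  by (cases a) auto

lemma snd_inv_letter [simp]: "snd (inv_letter a) = (\<not> snd a)"
  by (cases a) auto

lemma lf_cong_cancel': "fst a \<in> {1..n} \<Longrightarrow> lf_cong n [inv_letter a, a] []"
  using lf_cong_cancel[of "inv_letter a"] by simp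

lemma lf_cong_context:
  assumes "lf_cong n u v" "x \<in> words {1..n}" "y \<in> words {1..n}"
  shows "lf_cong n (x @ u @ y) (x @ v @ y)"
  using assms by (simp add: word_cong_append_left word_cong_append_right)

text \<open>The defining relations speak of positive letters only. Inserting \<open>a\<close> and
  its inverse and commuting in the middle gives the other signs.\<close>

lemma commute_inv_letter:
  assumes ab: "lf_cong n [a, b] [b, a]" and a: "fst a \<in> {1..n}" and b: "fst b \<in> {1..n}"
  shows "lf_cong n [inv_letter a, b] [b, inv_letter a]"
proof -
  let ?i = "inv_letter a"
  have "lf_cong n ([?i, b] @ [] @ []) ([?i, b] @ [a, ?i] @ [])"
    by (rule lf_cong_context) (use a b word_cong.sym[OF lf_cong_cancel] in auto)
  moreover have "lf_cong n ([?i] @ [b, a] @ [?i]) ([?i] @ [a, b] @ [?i])"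
    by (rule lf_cong_context) (use a b ab in \<open>auto intro: word_cong.sym\<close>)
  moreover have "lf_cong n ([] @ [?i, a] @ [b, ?i]) ([] @ [] @ [b, ?i])"
    by (rule lf_cong_context) (use a b in \<open>auto intro: lf_cong_cancel'\<close>)
  ultimately show ?thesis
    by simp (meson word_cong.trans)
qed

lemma letters_commute:
  assumes "fst a \<in> {1..n}" "fst b \<in> {1..n}" "fst a \<noteq> fst b" "\<not> near (fst a) (fst b)"
  shows "lf_cong n [a, b] [b, a]"
proof -
  obtain i d j e where ab: "a = (i, d)" "b = (j, e)" by (cases a, cases b)
  have "([(i, True), (j, True)], [(j, True), (i, True)]) \<in> locally_free_relations n"
    using assms ab by (auto simp: locally_free_relations_def near_def)
  then have tt: "lf_cong n [(i, True), (j, True)] [(j, True), (i, True)]"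
    using word_cong.relation[of "[]" "{1..n}" "[]" "[(i, True), (j, True)]" "[(j, True), (i, True)]"]
      assms ab by simp
  have dt: "lf_cong n [(i, d), (j, True)] [(j, True), (i, d)]"
    using tt commute_inv_letter[OF tt] assms ab by (cases d) auto
  have "lf_cong n [(j, e), (i, d)] [(i, d), (j, e)]"
    using dt commute_inv_letter[OF word_cong.sym[OF dt]] assms ab
    by (cases e) (auto intro: word_cong.sym)
  then show ?thesis using ab word_cong.sym by auto
qed

section \<open>Normal words and their uniqueness\<close>

lemma normal_word_words: "normal_word n w p \<Longrightarrow> w \<in> words {1..n}"
  by (induction rule: normal_word.induct) auto

text \<open>Every letter after a visible one lies in a column neither equal nor adjacent, for
  otherwise it would hide it; so the visible letter commutes to the end.\<close>

lemma normal_word_extract: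
  assumes "normal_word n w p" "top_sign p i = Some e"
  obtains w' p' where "p = push (i, e) p'" "normal_word n w' p'"
    "top_sign p' i \<noteq> Some (\<not> e)" "lf_cong n w (w' @ [(i, e)])" "length w = Suc (length w')"
    "i \<in> {1..n}"
  using assms
proof (induction arbitrary: thesis rule: normal_word.induct)
  case Nil
  then show ?case by (simp add: top_sign_def)
next
  case (snoc w p a)
  show ?case
  proof (cases "fst a = i")
    case True
    then have "a = (i, e)"
      using snoc.prems(2) by (cases a) (auto simp: top_sign_push)
    moreover have "w @ [a] \<in> words {1..n}"
      using snoc normal_word_words by simp
    ultimately show ?thesis
      using snoc.prems(1)[of p w] snoc.hyps lf_cong_refl by simp
  next
    case False
    then have nn: "\<not> near (fst a) i" and "top_sign p i = Some e"
      using snoc.prems(2) by (auto simp: top_sign_push split: if_splits)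
    then obtain w' p' where *: "p = push (i, e) p'" "normal_word n w' p'"
      "top_sign p' i \<noteq> Some (\<not> e)" "lf_cong n w (w' @ [(i, e)])" "length w = Suc (length w')"
      "i \<in> {1..n}"
      using snoc.IH by metis
    have w': "w' \<in> words {1..n}" using * normal_word_words by blast
    have 1: "push a p = push (i, e) (push a p')"
      using * False nn push_push_commute[of a "(i, e)" p'] by simp
    have 2: "normal_word n (w' @ [a]) (push a p')"
      using * False nn snoc.hyps by (intro normal_word.snoc) (auto simp: top_sign_push near_commute)
    have 3: "top_sign (push a p') i \<noteq> Some (\<not> e)"
      using * False nn by (auto simp: top_sign_push)
    have "lf_cong n (w @ [a]) ((w' @ [(i, e)]) @ [a])"
      using * snoc.hyps by (intro word_cong_append_right) auto
    moreover have "lf_cong n (w' @ [(i, e), a] @ []) (w' @ [a, (i, e)] @ [])"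
      by (intro lf_cong_context letters_commute)
        (use w' * False nn snoc.hyps in \<open>auto simp: near_commute\<close>)
    ultimately have 4: "lf_cong n (w @ [a]) ((w' @ [a]) @ [(i, e)])"
      by simp (meson word_cong.trans)
    show ?thesis using snoc.prems(1)[OF 1 2 3 4] * by simp
  qed
qed

lemma normal_word_empty:
  assumes "normal_word n w (\<lambda>_. [])"
  shows "w = []"
  using assms
proof (cases rule: normal_word.cases)
  case (snoc u p a)
  then have "push a p (fst a) = []" by metis
  then show ?thesis by (simp add: push_def)
qed auto

text \<open>The last letter of one word is visible in the piling, so it can be moved to the end of
  the other word and removed from both, \<open>push\<close> being injective.\<close>

lemma normal_word_unique:
  "normal_word n u p \<Longrightarrow> normal_word n v p \<Longrightarrow> lf_cong n u v"
proof (induction arbitrary: v rule: normal_word.induct)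
  case Nil
  then show ?case using normal_word_empty[OF Nil] by (simp add: lf_cong_refl)
next
  case (snoc w p a)
  have "top_sign (push a p) (fst a) = Some (snd a)" by (simp add: top_sign_push)
  from normal_word_extract[OF snoc.prems this] obtain v' p' where *: "push a p = push a p'"
    "normal_word n v' p'" "lf_cong n v (v' @ [a])"
    unfolding prod.collapse by metis
  then have "lf_cong n w v'" using snoc.IH[of v'] by (simp add: push_eq_iff)
  then have "lf_cong n (w @ [a]) (v' @ [a])"
    using snoc.hyps by (intro word_cong_append_right) auto
  then show ?case using * by (meson word_cong.sym word_cong.trans)
qed

section \<open>The action of words on pilings\<close>

lemma piling_cases:
  assumes "p \<in> pilings n" "top_sign p i = Some e"
  obtains q where "q \<in> pilings n" "p = push (i, e) q" "top_sign q i \<noteq> Some (\<not> e)" "i \<in> {1..n}"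
proof -
  obtain w where "normal_word n w p" using assms by (auto simp: pilings_def)
  then show ?thesis
    using assms(2) that by (rule normal_word_extract) (auto simp: pilings_def)
qed

lemma top_sign_column: "p \<in> pilings n \<Longrightarrow> top_sign p i = Some e \<Longrightarrow> i \<in> {1..n}"
  by (erule piling_cases)

lemma push_pilings:
  "p \<in> pilings n \<Longrightarrow> fst a \<in> {1..n} \<Longrightarrow> top_sign p (fst a) \<noteq> Some (\<not> snd a) \<Longrightarrow> push a p \<in> pilings n"
  unfolding pilings_def by (blast intro: normal_word.snoc)

lemma act_pilings:
  assumes "p \<in> pilings n" "fst a \<in> {1..n}"
  shows "act a p \<in> pilings n"
proof (cases "top_sign p (fst a) = Some (\<not> snd a)")
  case True
  then obtain q where "q \<in> pilings n" "p = push (fst a, \<not> snd a) q"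
    using piling_cases assms by metis
  then show ?thesis
    using True pop_push[of "(fst a, \<not> snd a)" q] by (simp add: act_def)
next
  case False
  then show ?thesis using assms by (simp add: act_def push_pilings)
qed

lemma empty_piling [simp]: "(\<lambda>_. []) \<in> pilings n"
  unfolding pilings_def by (blast intro: normal_word.Nil)

lemma fold_act_pilings:
  "w \<in> words {1..n} \<Longrightarrow> p \<in> pilings n \<Longrightarrow> fold act w p \<in> pilings n"
  by (induction w arbitrary: p) (simp_all add: act_pilings)

lemma act_inverse:
  assumes "p \<in> pilings n" "fst a \<in> {1..n}"
  shows "act (inv_letter a) (act a p) = p"
proof (cases "top_sign p (fst a) = Some (\<not> snd a)")
  case True
  \<comment> \<open>The second fact on \<open>q\<close> excludes another cancellation, so the
    inverse letter is pushed back.\<close>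
  from piling_cases[OF assms(1) this] obtain q where q: "p = push (fst a, \<not> snd a) q"
    "top_sign q (fst a) \<noteq> Some (snd a)" by auto
  have "inv_letter a = (fst a, \<not> snd a)" by (cases a) auto
  moreover have "pop (fst a) p = q" using q pop_push[of "(fst a, \<not> snd a)"] by simp
  ultimately show ?thesis using True q by (simp add: act_def)
next
  case False
  then show ?thesis by (simp add: act_def top_sign_push)
qed

lemma act_commute:
  assumes p: "p \<in> pilings n" and ab: "fst a \<noteq> fst b" "\<not> near (fst a) (fst b)"
  shows "act a (act b p) = act b (act a p)"
proof -
  note ba = ab(1)[symmetric] ab(2)[unfolded near_commute[of "fst a"]]
  \<comment> \<open>If \<open>x\<close> cancels, \<open>p\<close> is the inverse of \<open>x\<close>
    pushed onto some \<open>q\<close>, and the action of \<open>y\<close> slips below that letter.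
    By symmetry only the case of two pushes remains.\<close>
  have mixed: "act x (act y p) = act y (act x p)"
    if xy: "fst x \<noteq> fst y" "\<not> near (fst x) (fst y)" and
       x: "top_sign p (fst x) = Some (\<not> snd x)" for x y :: "nat letter"
  proof -
    note yx = xy(1)[symmetric] xy(2)[unfolded near_commute[of "fst x"]]
    obtain q where q: "q \<in> pilings n" "p = push (fst x, \<not> snd x) q"
      using piling_cases[OF p x] by metis
    have popp: "pop (fst x) (push (fst x, \<not> snd x) r) = r" for r
      using pop_push[of "(fst x, \<not> snd x)"] by simp
    have tx: "act x (push (fst x, \<not> snd x) r) = r" for r
      by (simp add: act_def top_sign_push popp)
    have ty: "top_sign p (fst y) = top_sign q (fst y)"
      using xy by (simp add: q top_sign_push)
    have "act y p = push (fst x, \<not> snd x) (act y q)"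
    proof (cases "top_sign q (fst y) = Some (\<not> snd y)")
      case True
      then obtain r where r: "q = push (fst y, \<not> snd y) r"
        using piling_cases[OF q(1)] by metis
      have popy: "pop (fst y) (push (fst y, \<not> snd y) s) = s" for s
        using pop_push[of "(fst y, \<not> snd y)"] by simp
      have "p = push (fst y, \<not> snd y) (push (fst x, \<not> snd x) r)"
        using q r push_push_commute[of "(fst x, \<not> snd x)" "(fst y, \<not> snd y)"] xy by simp
      then show ?thesis using True ty by (simp add: act_def r popy)
    next
      case False
      then show ?thesis using ty xy push_push_commute[of "(fst x, \<not> snd x)" y]
        by (simp add: act_def q)
    qed
    then show ?thesis using tx q by simp
  qed
  show ?thesis
  proof (cases "top_sign p (fst a) = Some (\<not> snd a) \<or> top_sign p (fst b) = Some (\<not> snd b)")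
    case True
    then show ?thesis using mixed[of a b] mixed[of b a] ab ba by auto
  next
    case False
    then show ?thesis using ab ba push_push_commute[OF ab]
      by (simp add: act_def top_sign_push)
  qed
qed

text \<open>Makes the piling an invariant of the group element: cancelling pairs act trivially by
  \<open>act_inverse\<close>, and the relations are respected by \<open>act_commute\<close>.\<close>

lemma fold_act_cong:
  "lf_cong n u v \<Longrightarrow> p \<in> pilings n \<Longrightarrow> fold act u p = fold act v p"
proof (induction arbitrary: p rule: word_cong.induct)
  case (cancel u v a)
  then have "fold act u p \<in> pilings n" by (auto intro: fold_act_pilings)
  then show ?case using cancel by (simp add: act_inverse mem_Times_iff)
next
  case (relation u v r s)
  then have "fold act u p \<in> pilings n" by (auto intro: fold_act_pilings)
  moreover have "fold act r q = fold act s q" if "q \<in> pilings n" for q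
    using relation(3) that
    by (auto simp: locally_free_relations_def near_def intro!: act_commute)
  ultimately show ?case using relation by simp
qed auto

lemma piling_of_cong: "lf_cong n u v \<Longrightarrow> piling_of u = piling_of v"
  unfolding piling_of_def by (auto intro: fold_act_cong)

lemma piling_of_Nil [simp]: "piling_of [] = (\<lambda>_. [])"
  by (simp add: piling_of_def)

lemma piling_of_snoc: "piling_of (w @ [a]) = act a (piling_of w)"
  by (simp add: piling_of_def)

lemma piling_of_pilings: "w \<in> words {1..n} \<Longrightarrow> piling_of w \<in> pilings n"
  unfolding piling_of_def by (auto intro: fold_act_pilings)

lemma piling_of_normal_word: "normal_word n w p \<Longrightarrow> piling_of w = p"
  by (induction rule: normal_word.induct) (auto simp: piling_of_snoc act_def)

text \<open>Letters are appended one at a time; a cancelling letter meets its inverse once that is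
  moved to the end, and the normal word gets shorter.\<close>

lemma normalize_word:
  "w \<in> words {1..n} \<Longrightarrow>
    \<exists>u. normal_word n u (piling_of w) \<and> lf_cong n w u \<and> length u \<le> length w"
proof (induction w rule: rev_induct)
  case Nil
  then show ?case by (auto intro: normal_word.Nil lf_cong_refl)
next
  case (snoc a w)
  then obtain u where u: "normal_word n u (piling_of w)" "lf_cong n w u" "length u \<le> length w"
    by auto
  have a: "fst a \<in> {1..n}" using snoc.prems by simp
  have wu: "lf_cong n (w @ [a]) (u @ [a])"
    using u a by (intro word_cong_append_right) auto
  show ?case
  proof (cases "top_sign (piling_of w) (fst a) = Some (\<not> snd a)")
    case True
    have inv: "inv_letter a = (fst a, \<not> snd a)" by (cases a) auto
    from normal_word_extract[OF u(1) True] obtain u' p' where u': "piling_of w = push (inv_letter a) p'"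
      "normal_word n u' p'" "lf_cong n u (u' @ [inv_letter a])" "length u = Suc (length u')"
      unfolding inv by metis
    have "piling_of (w @ [a]) = p'"
      using pop_push[of "inv_letter a" p'] by (simp add: piling_of_snoc act_def u' top_sign_push)
    moreover have "lf_cong n (u @ [a]) ((u' @ [inv_letter a]) @ [a])"
      using u' a by (intro word_cong_append_right) auto
    moreover have "lf_cong n (u' @ [inv_letter a, a] @ []) (u' @ [] @ [])"
      using a normal_word_words[OF u'(2)] by (intro lf_cong_context lf_cong_cancel') auto
    ultimately have "normal_word n u' (piling_of (w @ [a])) \<and> lf_cong n (w @ [a]) u'"
      using u' wu by simp (meson word_cong.trans)
    moreover have "length u' \<le> length (w @ [a])" using u u' by simp
    ultimately show ?thesis by blast
  next
    case False
    then have "normal_word n (u @ [a]) (piling_of (w @ [a]))"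
      using u a by (auto simp: piling_of_snoc act_def intro: normal_word.snoc)
    then show ?thesis using wu u by (metis Suc_le_mono length_append_singleton)
  qed
qed

lemma piling_of_eq_iff:
  assumes "u \<in> words {1..n}" "v \<in> words {1..n}"
  shows "piling_of u = piling_of v \<longleftrightarrow> lf_cong n u v"
proof
  assume eq: "piling_of u = piling_of v"
  obtain u' v' where "normal_word n u' (piling_of u)" "lf_cong n u u'"
    "normal_word n v' (piling_of v)" "lf_cong n v v'"
    using normalize_word assms by metis
  then show "lf_cong n u v"
    using eq normal_word_unique by (metis word_cong.sym word_cong.trans)
qed (rule piling_of_cong)

section \<open>Word length as the number of signs\<close>

definition occ :: "piling \<Rightarrow> nat \<Rightarrow> nat" where
  "occ p i = length (filter (\<lambda>s. s \<noteq> None) (p i))"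

definition piling_size :: "nat \<Rightarrow> piling \<Rightarrow> nat" where
  "piling_size n p = (\<Sum>i\<in>{1..n}. occ p i)"

lemma occ_empty [simp]: "occ (\<lambda>_. []) i = 0"
  by (simp add: occ_def)

lemma occ_push: "occ (push a p) i = occ p i + (if i = fst a then 1 else 0)"
  by (simp add: occ_def push_def)

lemma piling_size_empty [simp]: "piling_size n (\<lambda>_. []) = 0"
  by (simp add: piling_size_def)

lemma piling_size_push: "fst a \<in> {1..n} \<Longrightarrow> piling_size n (push a p) = Suc (piling_size n p)"
  by (simp add: piling_size_def occ_push sum.distrib)

lemma piling_size_normal_word: "normal_word n w p \<Longrightarrow> piling_size n p = length w"
  by (induction rule: normal_word.induct) (auto simp: piling_size_push)

text \<open>Normal words are geodesic: normalizing never lengthens a word, and every normal word of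
  a piling has length \<open>piling_size\<close>.\<close>

lemma lf_length_piling:
  assumes w: "w \<in> words {1..n}"
  shows "lf_length n (lf_elem n w) = piling_size n (piling_of w)"
  unfolding lf_length_def
proof (rule Least_equality)
  obtain u where u: "normal_word n u (piling_of w)" "lf_cong n w u"
    using normalize_word[OF w] by auto
  then have "lf_elem n u = lf_elem n w"
    using w by (simp add: word_class_eq_iff normal_word_words word_cong.sym)
  then show "\<exists>u\<in>words {1..n}. lf_elem n u = lf_elem n w \<and> length u = piling_size n (piling_of w)"
    using u normal_word_words piling_size_normal_word by metis
next
  fix k assume "\<exists>u\<in>words {1..n}. lf_elem n u = lf_elem n w \<and> length u = k"
  then obtain v where v: "v \<in> words {1..n}" "lf_elem n v = lf_elem n w" "length v = k" by auto
  then have "piling_of v = piling_of w" using piling_of_cong by (metis word_class_eq_iff)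
  moreover obtain u where "normal_word n u (piling_of v)" "length u \<le> length v"
    using normalize_word[OF v(1)] by auto
  ultimately show "piling_size n (piling_of w) \<le> k" using piling_size_normal_word v by metis
qed

definition piling_of_elem :: "nat letter list set \<Rightarrow> piling" where
  "piling_of_elem g = piling_of (SOME w. w \<in> g)"

lemma piling_of_elem [simp]:
  assumes "w \<in> words {1..n}"
  shows "piling_of_elem (lf_elem n w) = piling_of w"
proof -
  have "w \<in> lf_elem n w" using assms by (simp add: word_class_def lf_cong_refl)
  then have "(SOME v. v \<in> lf_elem n w) \<in> lf_elem n w" by (rule someI)
  then show ?thesis unfolding piling_of_elem_def word_class_def by (simp add: piling_of_cong)
qed

lemma carrier_locally_free_group:
  "carrier (locally_free_group n) = lf_elem n ` words {1..n}"
  by (simp add: locally_free_group_def presented_group_def)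

lemma bij_betw_piling_of_elem:
  "bij_betw piling_of_elem (carrier (locally_free_group n)) (pilings n)"
proof (rule bij_betw_imageI)
  show "inj_on piling_of_elem (carrier (locally_free_group n))"
    by (auto simp: inj_on_def carrier_locally_free_group word_class_eq_iff piling_of_eq_iff)
  show "piling_of_elem ` carrier (locally_free_group n) = pilings n"
  proof
    show "piling_of_elem ` carrier (locally_free_group n) \<subseteq> pilings n"
      by (auto simp: carrier_locally_free_group piling_of_pilings)
    show "pilings n \<subseteq> piling_of_elem ` carrier (locally_free_group n)"
    proof
      fix p assume "p \<in> pilings n"
      then obtain w where w: "normal_word n w p" by (auto simp: pilings_def)
      then have "p = piling_of_elem (lf_elem n w)" "w \<in> words {1..n}"
        using piling_of_normal_word normal_word_words by auto
      then show "p \<in> piling_of_elem ` carrier (locally_free_group n)"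
        unfolding carrier_locally_free_group by blast
    qed
  qed
qed

lemma lf_length_eq_piling_size:
  "g \<in> carrier (locally_free_group n) \<Longrightarrow> lf_length n g = piling_size n (piling_of_elem g)"
  by (auto simp: carrier_locally_free_group lf_length_piling)

lemma sphere_size_pilings: "sphere_size n K = card {p \<in> pilings n. piling_size n p = K}"
proof -
  have "bij_betw piling_of_elem {g \<in> carrier (locally_free_group n). lf_length n g = K}
     {p \<in> pilings n. piling_size n p = K}"
    using bij_betw_piling_of_elem
    by (rule bij_betw_Collect) (simp add: lf_length_eq_piling_size)
  then show ?thesis unfolding sphere_size_def by (rule bij_betw_same_card)
qed

subsection \<open>Weighted sums over pilings\<close>

definition weight :: "(nat \<Rightarrow> real) \<Rightarrow> nat \<Rightarrow> piling \<Rightarrow> real" where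
  "weight t n p = (\<Prod>i\<in>{1..n}. t i ^ occ p i)"

text \<open>The size bound \<open>K\<close> keeps the sums finite; \<open>F m\<close> of the
  introductory comment is the limit of \<open>from_sum t n m K\<close> for growing
  \<open>K\<close>.\<close>

definition pilings_from :: "nat \<Rightarrow> nat \<Rightarrow> nat \<Rightarrow> piling set" where
  "pilings_from n m K = {p \<in> pilings n. piling_size n p \<le> K \<and> (\<forall>i<m. top_sign p i = None)}"

definition pilings_with_top :: "nat \<Rightarrow> nat \<Rightarrow> nat \<Rightarrow> bool \<Rightarrow> piling set" where
  "pilings_with_top n m K e = {p \<in> pilings_from n m K. top_sign p m = Some e}"

definition from_sum :: "(nat \<Rightarrow> real) \<Rightarrow> nat \<Rightarrow> nat \<Rightarrow> nat \<Rightarrow> real" where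
  "from_sum t n m K = sum (weight t n) (pilings_from n m K)"

definition top_sum :: "(nat \<Rightarrow> real) \<Rightarrow> nat \<Rightarrow> nat \<Rightarrow> nat \<Rightarrow> real" where
  "top_sum t n m K = (\<Sum>e\<in>UNIV. sum (weight t n) (pilings_with_top n m K e))"

lemma weight_empty [simp]: "weight t n (\<lambda>_. []) = 1"
  by (simp add: weight_def)

lemma weight_push:
  assumes "fst a \<in> {1..n}"
  shows "weight t n (push a p) = t (fst a) * weight t n p"
proof -
  have "weight t n (push a p) = (\<Prod>i\<in>{1..n}. (if i = fst a then t i else 1) * t i ^ occ p i)"
    unfolding weight_def by (intro prod.cong) (auto simp: occ_push power_add mult.commute)
  also have "\<dots> = (\<Prod>i\<in>{1..n}. if i = fst a then t i else 1) * weight t n p"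
    by (simp add: prod.distrib weight_def)
  finally show ?thesis using assms by simp
qed

lemma weight_nonneg: "(\<And>i. 0 \<le> t i) \<Longrightarrow> 0 \<le> weight t n p"
  by (simp add: weight_def prod_nonneg)

lemma weight_const: "weight (\<lambda>_. t) n p = t ^ piling_size n p"
  by (simp add: weight_def piling_size_def power_sum)

lemma finite_pilings_piling_size: "finite {p \<in> pilings n. piling_size n p \<le> K}"
proof (rule finite_subset)
  show "{p \<in> pilings n. piling_size n p \<le> K}
      \<subseteq> piling_of ` {w. set w \<subseteq> {1..n} \<times> UNIV \<and> length w \<le> K}"
  proof
    fix p assume "p \<in> {p \<in> pilings n. piling_size n p \<le> K}"
    then obtain w where w: "normal_word n w p" "length w \<le> K"
      by (auto simp: pilings_def piling_size_normal_word)
    then have "w \<in> words {1..n}" "p = piling_of w"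
      using normal_word_words piling_of_normal_word by auto
    then show "p \<in> piling_of ` {w. set w \<subseteq> {1..n} \<times> UNIV \<and> length w \<le> K}"
      using w by (auto simp: words_def lists_eq_set)
  qed
qed (intro finite_imageI finite_lists_length_le, simp)

lemma finite_pilings_from [simp]: "finite (pilings_from n m K)"
  by (rule finite_subset[OF _ finite_pilings_piling_size[of n K]]) (auto simp: pilings_from_def)

lemma finite_pilings_with_top [simp]: "finite (pilings_with_top n m K e)"
  by (rule finite_subset[OF _ finite_pilings_from[of n m K]]) (auto simp: pilings_with_top_def)

lemma top_sign_near:
  assumes "p \<in> pilings n" "top_sign p i = Some e" "near i j"
  shows "top_sign p j = None"
proof -
  obtain q where "p = push (i, e) q" using assms piling_cases by metis
  then show ?thesis using assms by (auto simp: top_sign_push)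
qed

lemma from_sum_split: "from_sum t n m K = from_sum t n (Suc m) K + top_sum t n m K"
proof -
  have "pilings_from n m K = pilings_from n (Suc m) K \<union>
      (pilings_with_top n m K True \<union> pilings_with_top n m K False)"
    by (auto simp: pilings_from_def pilings_with_top_def less_Suc_eq)
  moreover have "pilings_from n (Suc m) K \<inter>
      (pilings_with_top n m K True \<union> pilings_with_top n m K False) = {}"
    "pilings_with_top n m K True \<inter> pilings_with_top n m K False = {}"
    by (auto simp: pilings_from_def pilings_with_top_def)
  ultimately show ?thesis
    by (simp add: from_sum_def top_sum_def sum.union_disjoint UNIV_bool add.commute)
qed

text \<open>Pushing a letter in column \<open>Suc m\<close> hides column \<open>m\<close>, so only
  the columns below \<open>m\<close> must show nothing beforehand. The push is a bijection onto
  pilings larger by one letter, once those showing the inverse letter are left out.\<close>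

lemma from_sum_push:
  assumes m: "m < n"
  shows "t (Suc m) * from_sum t n m K = sum (weight t n) (pilings_with_top n (Suc m) (Suc K) e)
    + t (Suc m) * sum (weight t n) (pilings_with_top n (Suc m) K (\<not> e))"
proof -
  let ?m = "Suc m"
  let ?A = "{p \<in> pilings_from n m K. top_sign p ?m \<noteq> Some (\<not> e)}"
  have m': "?m \<in> {1..n}" using m by auto
  \<comment> \<open>A visible letter in column \<open>Suc m\<close> covers column \<open>m\<close>,
    which makes the condition on column \<open>m\<close> automatic.\<close>
  have B: "{p \<in> pilings_from n m K. top_sign p ?m = Some (\<not> e)} = pilings_with_top n ?m K (\<not> e)"
  proof -
    have "top_sign p m = None" if "p \<in> pilings n" "top_sign p ?m = Some (\<not> e)" for p
      using top_sign_near[OF that] by (simp add: near_def)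
    then show ?thesis by (auto simp: pilings_from_def pilings_with_top_def less_Suc_eq)
  qed
  have "pilings_from n m K = ?A \<union> {p \<in> pilings_from n m K. top_sign p ?m = Some (\<not> e)}"
    by auto
  then have "from_sum t n m K = sum (weight t n) ?A + sum (weight t n) (pilings_with_top n ?m K (\<not> e))"
    unfolding from_sum_def using B
    by (metis (no_types, lifting) sum.union_disjoint finite_pilings_from finite_Un
        disjoint_iff mem_Collect_eq)
  moreover have "t ?m * sum (weight t n) ?A = sum (weight t n) (pilings_with_top n ?m (Suc K) e)"
  proof -
    have "push (?m, e) ` ?A = pilings_with_top n ?m (Suc K) e"
    proof
      show "push (?m, e) ` ?A \<subseteq> pilings_with_top n ?m (Suc K) e"
        using m' push_pilings[of _ n "(?m, e)"]
        by (auto simp: pilings_from_def pilings_with_top_def piling_size_push top_sign_push near_def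
            less_Suc_eq)
      show "pilings_with_top n ?m (Suc K) e \<subseteq> push (?m, e) ` ?A"
      proof
        fix p assume p: "p \<in> pilings_with_top n ?m (Suc K) e"
        then obtain q where q: "q \<in> pilings n" "p = push (?m, e) q" "top_sign q ?m \<noteq> Some (\<not> e)"
          by (auto simp: pilings_from_def pilings_with_top_def elim: piling_cases)
        have "piling_size n q \<le> K"
          using p q m' by (simp add: pilings_from_def pilings_with_top_def piling_size_push)
        moreover have "top_sign q i = None" if "i < m" for i
        proof -
          have "top_sign p i = None"
            using p that by (simp add: pilings_from_def pilings_with_top_def)
          then show ?thesis using that q by (auto simp: top_sign_push near_def)
        qed
        ultimately show "p \<in> push (?m, e) ` ?A" using q by (auto simp: pilings_from_def)
      qed
    qed
    moreover have "inj_on (push (?m, e)) ?A" by (auto simp: inj_on_def push_eq_iff)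
    ultimately have "sum (weight t n) (pilings_with_top n ?m (Suc K) e)
      = (\<Sum>p\<in>?A. weight t n (push (?m, e) p))"
      by (metis (no_types, lifting) sum.reindex comp_apply sum.cong)
    then show ?thesis using m' by (simp add: weight_push sum_distrib_left)
  qed
  ultimately show ?thesis by (simp add: distrib_left)
qed

lemma top_sum_recurrence:
  assumes "m < n"
  shows "top_sum t n (Suc m) (Suc K) + t (Suc m) * top_sum t n (Suc m) K
    = 2 * t (Suc m) * from_sum t n m K"
  using from_sum_push[OF assms, of t K True] from_sum_push[OF assms, of t K False]
  by (simp add: top_sum_def UNIV_bool algebra_simps)

section \<open>Monotonicity and boundary values of the truncated sums\<close>

lemma from_sum_mono:
  assumes "\<And>i. 0 \<le> t i" "K \<le> L"
  shows "from_sum t n m K \<le> from_sum t n m L"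
  unfolding from_sum_def
proof (rule sum_mono2)
  show "pilings_from n m K \<subseteq> pilings_from n m L"
    using assms(2) by (auto simp: pilings_from_def)
qed (use assms in \<open>auto simp: weight_nonneg\<close>)

lemma from_sum_nonneg: "(\<And>i. 0 \<le> t i) \<Longrightarrow> 0 \<le> from_sum t n m K"
  unfolding from_sum_def by (auto intro: sum_nonneg weight_nonneg)

lemma top_sum_nonneg: "(\<And>i. 0 \<le> t i) \<Longrightarrow> 0 \<le> top_sum t n m K"
  unfolding top_sum_def by (auto intro!: sum_nonneg weight_nonneg)

lemma top_sum_mono:
  assumes "\<And>i. 0 \<le> t i" "K \<le> L"
  shows "top_sum t n m K \<le> top_sum t n m L"
  unfolding top_sum_def
proof (intro sum_mono sum_mono2)
  show "pilings_with_top n m K e \<subseteq> pilings_with_top n m L e" for e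
    using assms(2) by (auto simp: pilings_with_top_def pilings_from_def)
qed (use assms in \<open>auto simp: weight_nonneg\<close>)

text \<open>The left boundary condition of the recurrence: column 0 holds nothing but
  blanks.\<close>

lemma from_sum_0: "from_sum t n 0 K = from_sum t n 1 K"
proof -
  have "top_sign p 0 = None" if "p \<in> pilings n" for p
    using top_sign_column[OF that, of 0] by (cases "top_sign p 0") auto
  then have "pilings_from n 0 K = pilings_from n 1 K"
    by (auto simp: pilings_from_def)
  then show ?thesis by (simp add: from_sum_def)
qed

text \<open>The right boundary condition: the last letter of a nonempty normal word is visible, so
  only the empty piling is left.\<close>

lemma from_sum_last: "from_sum t n (Suc n) K = 1"
proof -
  have "p = (\<lambda>_. [])" if p: "p \<in> pilings n" "\<forall>i<Suc n. top_sign p i = None" for p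
  proof -
    obtain w where "normal_word n w p" using p by (auto simp: pilings_def)
    then show ?thesis
    proof (cases rule: normal_word.cases)
      case (snoc w q a)
      then have "top_sign p (fst a) = Some (snd a)" by (simp add: top_sign_push)
      then show ?thesis using p snoc by auto
    qed
  qed
  then have "pilings_from n (Suc n) K = {\<lambda>_. []}"
    by (auto simp: pilings_from_def top_sign_def)
  then show ?thesis by (simp add: from_sum_def)
qed

text \<open>Truncation turns the recurrence into two inequalities. Here \<open>top_sum\<close> at
  size \<open>K\<close> is bounded by that at \<open>Suc K\<close>; replacing the other term instead
  gives \<open>from_sum_le\<close>.\<close>

lemma from_sum_ge:
  assumes t: "\<And>i. 0 \<le> t i" and m: "m < n"
  shows "from_sum t n (Suc (Suc m)) K
    \<ge> from_sum t n (Suc m) K - 2 * t (Suc m) / (1 + t (Suc m)) * from_sum t n m K"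
proof -
  have "(1 + t (Suc m)) * top_sum t n (Suc m) K \<le> 2 * t (Suc m) * from_sum t n m K"
    using top_sum_recurrence[OF m, of t K] top_sum_mono[of t K "Suc K" n "Suc m"] t
    by (simp add: distrib_right)
  moreover have "1 + t (Suc m) > 0" using t[of "Suc m"] by linarith
  ultimately have "top_sum t n (Suc m) K \<le> 2 * t (Suc m) / (1 + t (Suc m)) * from_sum t n m K"
    by (simp add: field_simps)
  then show ?thesis using from_sum_split[of t n "Suc m" K] by linarith
qed

lemma from_sum_le:
  assumes t: "\<And>i. 0 \<le> t i" and m: "m < n"
  shows "from_sum t n (Suc (Suc m)) (Suc K)
    \<le> from_sum t n (Suc m) (Suc K) - 2 * t (Suc m) / (1 + t (Suc m)) * from_sum t n m K"
proof -
  have "t (Suc m) * top_sum t n (Suc m) K \<le> t (Suc m) * top_sum t n (Suc m) (Suc K)"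
    using t by (intro mult_left_mono top_sum_mono) auto
  then have "(1 + t (Suc m)) * top_sum t n (Suc m) (Suc K) \<ge> 2 * t (Suc m) * from_sum t n m K"
    using top_sum_recurrence[OF m, of t K] by (simp add: distrib_right)
  moreover have "1 + t (Suc m) > 0" using t[of "Suc m"] by linarith
  ultimately have "top_sum t n (Suc m) (Suc K) \<ge> 2 * t (Suc m) / (1 + t (Suc m)) * from_sum t n m K"
    by (simp add: field_simps)
  then show ?thesis using from_sum_split[of t n "Suc m" "Suc K"] by linarith
qed

text \<open>The weights are chosen so that \<open>2 * t / (1 + t)\<close> is \<open>1 / 2\<close> in the first column and
  \<open>1 / 4\<close>, the critical value for infinitely many columns, in the others.\<close>

definition crit :: "nat \<Rightarrow> real" where
  "crit i = (if i = 1 then 1 / 3 else 1 / 7)"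

lemma crit_pos: "0 < crit i"
  by (simp add: crit_def)

lemma sum_crit_weight_le: "sum (weight crit n) {p \<in> pilings n. piling_size n p \<le> K} \<le> 2 ^ n"
proof -
  have nonneg: "0 \<le> crit i" for i using crit_pos less_imp_le by blast
  \<comment> \<open>Subtracting a quarter of \<open>F m\<close>, which is at most half of
    \<open>F (m + 1)\<close>, leaves at least half of \<open>F (m + 1)\<close>. In column 1 half of
    \<open>F 0 = F 1\<close> may be subtracted, which is what allows the weight
    \<open>1 / 3\<close>.\<close>
  have step: "from_sum crit n (Suc m) K \<le> 2 * from_sum crit n (Suc (Suc m)) K" if "m < n" for m
    using that
  proof (induction m)
    case 0
    then show ?case
      using from_sum_ge[of crit 0 n K] nonneg from_sum_0[of crit n K]
      by (simp add: crit_def[of "Suc 0"] One_nat_def)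
  next
    case (Suc m)
    then show ?case
      using from_sum_ge[of crit "Suc m" n K] nonneg by (simp add: crit_def[of "Suc (Suc m)"] One_nat_def)
  qed
  have "from_sum crit n 1 K \<le> 2 ^ m * from_sum crit n (Suc m) K" if "m \<le> n" for m
    using that
  proof (induction m)
    case (Suc m)
    have "from_sum crit n 1 K \<le> 2 ^ m * from_sum crit n (Suc m) K" using Suc by simp
    also have "\<dots> \<le> 2 ^ m * (2 * from_sum crit n (Suc (Suc m)) K)"
      using Suc step by (intro mult_left_mono) auto
    finally show ?case by (simp only: power_Suc mult_ac)
  qed (simp add: One_nat_def)
  from this[of n] show ?thesis
    using from_sum_0[of crit n K] by (simp add: from_sum_last) (simp add: from_sum_def pilings_from_def)
qed

text \<open>A Sturm comparison with the solution \<open>sin (m * \<theta>) / (2 * cos \<theta>) ^ m\<close> for equality, which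
  vanishes at \<open>m = n + 1\<close>.\<close>

lemma no_positive_solution:
  fixes L :: "nat \<Rightarrow> real"
  assumes n: "n \<ge> 2" and pos: "\<And>m. L m > 0"
    and rec: "\<And>m. m < n \<Longrightarrow> L (Suc (Suc m)) \<le> L (Suc m) - L m / (4 * cos (pi / (n + 1)) ^ 2)"
  shows False
proof -
  define th where "th = pi / (n + 1)"
  define c where "c = cos th"
  define S where "S m = sin (m * th) / (2 * c) ^ m" for m :: nat
  have th: "0 < th" "th < pi / 2"
    using n unfolding th_def by (auto simp: field_simps)
  then have c: "c > 0" unfolding c_def by (intro cos_gt_zero) auto
  have S_nonneg: "S m \<ge> 0" if "m \<le> Suc n" for m
  proof -
    have "real m * th \<le> real (Suc n) * th"
      using that th by (intro mult_right_mono) auto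
    also have "real (Suc n) * th = pi" by (simp add: th_def field_simps)
    finally have "sin (m * th) \<ge> 0" using th by (intro sin_ge_zero) auto
    then show ?thesis using c by (simp add: S_def)
  qed
  have S_rec: "S (Suc (Suc m)) = S (Suc m) - S m / (4 * c ^ 2)" for m
  proof -
    let ?x = "real (Suc m) * th"
    have "real (Suc (Suc m)) * th = ?x + th" "real m * th = ?x - th"
      by (simp_all add: algebra_simps)
    then have "sin (real (Suc (Suc m)) * th) = 2 * c * sin ?x - sin (real m * th)"
      by (simp only: sin_add sin_diff c_def) simp
    then show ?thesis using c unfolding S_def by (simp add: field_simps power2_eq_square)
  qed
  \<comment> \<open>A discrete Wronskian inequality. It starts from \<open>S 0 = 0\<close> and
    propagates because \<open>L\<close> satisfies the recurrence as an inequality; at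
    \<open>m = n\<close> the right side vanishes while the left is nonnegative.\<close>
  have "L (Suc m) * S m < L m * S (Suc m)" if "m \<le> n" for m
    using that
  proof (induction m)
    case 0
    have "S 1 > 0" using th c sin_gt_zero[of th] by (simp add: S_def)
    then have "0 < L 0 * S 1" using pos by simp
    then show ?case by (simp add: S_def[of 0] One_nat_def)
  next
    case (Suc m)
    have "L (Suc (Suc m)) * S (Suc m) \<le> (L (Suc m) - L m / (4 * c ^ 2)) * S (Suc m)"
      using rec[of m] Suc.prems S_nonneg[of "Suc m"] unfolding c_def th_def
      by (intro mult_right_mono) auto
    also have "\<dots> = L (Suc m) * S (Suc m) - (L m * S (Suc m)) / (4 * c ^ 2)"
      by (simp add: algebra_simps)
    also have "\<dots> < L (Suc m) * S (Suc m) - (L (Suc m) * S m) / (4 * c ^ 2)"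
      using Suc c by (intro diff_strict_left_mono divide_strict_right_mono) auto
    also have "\<dots> = L (Suc m) * S (Suc (Suc m))"
      unfolding S_rec by (simp add: algebra_simps)
    finally show ?case .
  qed
  from this[of n] have "L (Suc n) * S n < L n * S (Suc n)" by simp
  moreover have "S (Suc n) = 0"
  proof -
    have "real (Suc n) * th = pi" by (simp add: th_def field_simps)
    then show ?thesis unfolding S_def by (simp only: sin_pi)
  qed
  moreover have "0 \<le> L (Suc n) * S n"
    using pos[of "Suc n"] S_nonneg[of n] by (intro mult_nonneg_nonneg) auto
  ultimately show False by simp
qed

text \<open>Bounded sums would converge as \<open>K\<close> grows, and their limits would be a
  positive solution excluded by \<open>no_positive_solution\<close>.\<close>

lemma from_sum_unbounded:
  assumes n: "n \<ge> 2" and t: "0 < t" "2 * t / (1 + t) = 1 / (4 * cos (pi / (n + 1)) ^ 2)"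
  shows "\<not> (\<exists>M. \<forall>K. from_sum (\<lambda>_. t) n 0 K \<le> M)"
proof
  assume "\<exists>M. \<forall>K. from_sum (\<lambda>_. t) n 0 K \<le> M"
  then obtain M where M: "\<And>K. from_sum (\<lambda>_. t) n 0 K \<le> M" by blast
  \<comment> \<open>Capping the index at \<open>n + 1\<close> continues the sequence by the value 1,
    so that positivity holds for all \<open>m\<close>; the recurrence for \<open>m < n\<close> is
    unaffected.\<close>
  let ?F = "\<lambda>m K. from_sum (\<lambda>_. t) n (min m (Suc n)) K"
  have dec: "from_sum (\<lambda>_. t) n (Suc m) K \<le> from_sum (\<lambda>_. t) n m K" for m K
    using from_sum_split[of "\<lambda>_. t" n m K] top_sum_nonneg[of "\<lambda>_. t" n m K] t by simp
  have anti: "from_sum (\<lambda>_. t) n k K \<le> from_sum (\<lambda>_. t) n m K" if "m \<le> k" for m k K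
    using that by (rule lift_Suc_antimono_le[where f = "\<lambda>m. from_sum (\<lambda>_. t) n m K", OF dec])
  define L where "L m = lim (?F m)" for m
  have conv: "?F m \<longlonglongrightarrow> L m" for m
  proof -
    have "convergent (?F m)"
    proof (rule Bseq_mono_convergent)
      show "Bseq (?F m)"
      proof (rule BseqI'[where K = M])
        fix K
        show "norm (?F m K) \<le> M"
          using from_sum_nonneg[of "\<lambda>_. t" n "min m (Suc n)" K] t M[of K] anti[of 0 "min m (Suc n)" K] by simp
      qed
    qed (use t from_sum_mono in simp)
    then show ?thesis unfolding L_def by (rule convergent_LIMSEQ_iff[THEN iffD1])
  qed
  have "L m \<ge> 1" for m
  proof (rule LIMSEQ_le_const[OF conv])
    show "\<exists>N. \<forall>K\<ge>N. 1 \<le> ?F m K"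
      using anti[of "min m (Suc n)" "Suc n"] by (auto simp: from_sum_last)
  qed
  then have "L m > 0" for m by (smt (verit))
  moreover have "L (Suc (Suc m)) \<le> L (Suc m) - L m / (4 * cos (pi / (n + 1)) ^ 2)" if "m < n" for m
  proof (rule LIMSEQ_le)
    show "(\<lambda>K. ?F (Suc (Suc m)) (Suc K)) \<longlonglongrightarrow> L (Suc (Suc m))"
      using conv by (rule LIMSEQ_Suc)
    show "(\<lambda>K. ?F (Suc m) (Suc K) - ?F m K / (4 * cos (pi / (n + 1)) ^ 2))
      \<longlonglongrightarrow> L (Suc m) - L m / (4 * cos (pi / (n + 1)) ^ 2)"
      unfolding divide_inverse by (intro tendsto_intros LIMSEQ_Suc conv)
    show "\<exists>N. \<forall>K\<ge>N. ?F (Suc (Suc m)) (Suc K)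
        \<le> ?F (Suc m) (Suc K) - ?F m K / (4 * cos (pi / (n + 1)) ^ 2)"
      using from_sum_le[of "\<lambda>_. t" m n] t that by (auto simp: min_def)
  qed
  ultimately show False using no_positive_solution[OF n, of L] by blast
qed

subsection \<open>The logarithmic volume\<close>

text \<open>Fekete's lemma: the limit is the infimum \<open>L\<close>. It serves both the volume and
  the entropy.\<close>

lemma subadditive_convergent:
  fixes u :: "nat \<Rightarrow> real"
  assumes sub: "\<And>m n. u (m + n) \<le> u m + u n" and nonneg: "\<And>n. 0 \<le> u n"
  shows "convergent (\<lambda>n. u n / real n)"
proof -
  define L where "L = (INF n\<in>{1..}. u n / real n)"
  have bdd: "bdd_below ((\<lambda>n. u n / real n) ` {1..})"
    by (rule bdd_belowI[of _ 0]) (use nonneg in auto)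
  have L_le: "L \<le> u n / real n" if "n \<ge> 1" for n
    unfolding L_def by (rule cINF_lower[OF bdd]) (use that in auto)
  \<comment> \<open>\<open>k = 0\<close> is left out because \<open>u 0\<close> may be positive;
    below, \<open>n\<close> at least \<open>m\<close> keeps the quotient \<open>n div m\<close>
    positive.\<close>
  have mult: "u (k * m) \<le> real k * u m" if "k \<ge> 1" for k m
    using that
  proof (induction k rule: dec_induct)
    case (step k)
    then show ?case using sub[of m "k * m"] by (simp add: algebra_simps)
  qed simp
  have "(\<lambda>n. u n / real n) \<longlonglongrightarrow> L"
  proof (rule LIMSEQ_I)
    fix r :: real assume r: "0 < r"
    have "L < L + r / 2" using r by simp
    then obtain m where m: "m \<ge> 1" "u m / real m < L + r / 2"
      unfolding L_def using cINF_less_iff[OF _ bdd] by (metis atLeast_iff empty_iff order_refl)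
    define B where "B = Max (u ` {..<m})"
    have B: "u j \<le> B" if "j < m" for j
      unfolding B_def using that by (intro Max_ge) auto
    obtain N :: nat where N: "real N > 2 * B / r" using reals_Archimedean2 by blast
    show "\<exists>no. \<forall>n\<ge>no. norm (u n / real n - L) < r"
    proof (intro exI allI impI)
      fix n assume n: "n \<ge> max (Suc N) m"
      then have n0: "real n > 0" using m by auto
      have nd: "n = n div m * m + n mod m" by simp
      have "n div m \<ge> 1" using n m by (simp add: less_eq_div_iff_mult_less_eq)
      then have "u (n div m * m) \<le> real (n div m) * u m" by (rule mult)
      moreover have "u (n mod m) \<le> B" using m by (intro B) auto
      moreover have "u n \<le> u (n div m * m) + u (n mod m)" using sub nd by metis
      ultimately have "u n \<le> real (n div m) * u m + B" by linarith
      also have "real (n div m) * u m \<le> (real n / real m) * u m"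
        using nonneg of_nat_div_le_of_nat[of n m] by (intro mult_right_mono) auto
      finally have "u n / real n \<le> u m / real m + B / real n"
        using n0 m by (simp add: field_simps)
      moreover have "B / real n < r / 2"
      proof -
        have "2 * B / r < real n" using N n by linarith
        then show ?thesis using r n0 by (simp add: field_simps)
      qed
      moreover have "L \<le> u n / real n" using n m by (intro L_le) auto
      ultimately have "u n / real n < L + r" "L \<le> u n / real n" using m(2) by linarith+
      then show "norm (u n / real n - L) < r" by simp
    qed
  qed
  then show ?thesis by (rule convergentI)
qed

section \<open>Submultiplicativity of the sphere sizes\<close>

lemma lf_length_le: "w \<in> words {1..n} \<Longrightarrow> lf_length n (lf_elem n w) \<le> length w"
  unfolding lf_length_def by (rule Least_le) auto

lemma lf_length_word:
  assumes "g \<in> carrier (locally_free_group n)"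
  obtains w where "w \<in> words {1..n}" "g = lf_elem n w" "length w = lf_length n g"
proof -
  obtain v where "v \<in> words {1..n}" "lf_elem n v = g"
    using assms by (auto simp: carrier_locally_free_group)
  then have "\<exists>k. \<exists>w\<in>words {1..n}. lf_elem n w = g \<and> length w = k" by blast
  from LeastI_ex[OF this] show ?thesis using that unfolding lf_length_def by blast
qed

lemma lf_elem_mult:
  "u \<in> words {1..n} \<Longrightarrow> v \<in> words {1..n} \<Longrightarrow>
    lf_elem n u \<otimes>\<^bsub>locally_free_group n\<^esub> lf_elem n v = lf_elem n (u @ v)"
  unfolding locally_free_group_def by (rule presented_group_mult)

abbreviation length_sphere :: "nat \<Rightarrow> nat \<Rightarrow> nat letter list set set" where
  "length_sphere n K \<equiv> {g \<in> carrier (locally_free_group n). lf_length n g = K}"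

lemma finite_length_sphere: "finite (length_sphere n K)"
proof (rule finite_subset)
  show "length_sphere n K \<subseteq> lf_elem n ` {w. set w \<subseteq> {1..n} \<times> UNIV \<and> length w \<le> K}"
  proof
    fix g assume g: "g \<in> length_sphere n K"
    then have "g \<in> carrier (locally_free_group n)" by simp
    then obtain w where "w \<in> words {1..n}" "g = lf_elem n w" "length w = lf_length n g"
      by (rule lf_length_word)
    then show "g \<in> lf_elem n ` {w. set w \<subseteq> {1..n} \<times> UNIV \<and> length w \<le> K}"
      using g by (auto simp: words_def lists_eq_set)
  qed
qed (intro finite_imageI finite_lists_length_le, simp)

text \<open>A geodesic word is cut after \<open>K\<close> letters; both pieces are geodesic, since a
  shorter word for one of them would shorten the whole.\<close>

lemma sphere_add_subset:
  "length_sphere n (K + L) \<subseteq> (\<lambda>(g, h). g \<otimes>\<^bsub>locally_free_group n\<^esub> h) ` (length_sphere n K \<times> length_sphere n L)"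
proof
  fix g assume g: "g \<in> length_sphere n (K + L)"
  then have "g \<in> carrier (locally_free_group n)" by simp
  then obtain w where w: "w \<in> words {1..n}" "g = lf_elem n w" "length w = lf_length n g"
    by (rule lf_length_word)
  then have len: "length w = K + L" using g by simp
  define u v where "u = take K w" and "v = drop K w"
  have uv: "w = u @ v" "length u = K" "length v = L" "u \<in> words {1..n}" "v \<in> words {1..n}"
  proof -
    show *: "w = u @ v" by (simp add: u_def v_def)
    show "u \<in> words {1..n}" "v \<in> words {1..n}" using w(1) unfolding * by auto
  qed (use len in \<open>auto simp: u_def v_def\<close>)
  have carr: "lf_elem n u \<in> carrier (locally_free_group n)" "lf_elem n v \<in> carrier (locally_free_group n)"
    using uv by (auto simp: carrier_locally_free_group)
  obtain u' where u': "u' \<in> words {1..n}" "lf_elem n u = lf_elem n u'" "length u' = lf_length n (lf_elem n u)"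
    using lf_length_word[OF carr(1)] by metis
  obtain v' where v': "v' \<in> words {1..n}" "lf_elem n v = lf_elem n v'" "length v' = lf_length n (lf_elem n v)"
    using lf_length_word[OF carr(2)] by metis
  have g_eq: "g = lf_elem n u \<otimes>\<^bsub>locally_free_group n\<^esub> lf_elem n v"
    using w uv by (simp add: lf_elem_mult)
  then have "g = lf_elem n (u' @ v')" using u' v' by (simp add: lf_elem_mult)
  then have "lf_length n g \<le> length (u' @ v')" using u' v' by (simp only:) (intro lf_length_le, simp)
  moreover have "lf_length n (lf_elem n u) \<le> K" "lf_length n (lf_elem n v) \<le> L"
    using uv lf_length_le by metis+
  ultimately have "lf_length n (lf_elem n u) = K" "lf_length n (lf_elem n v) = L"
    using g u' v' by auto
  then show "g \<in> (\<lambda>(g, h). g \<otimes>\<^bsub>locally_free_group n\<^esub> h) ` (length_sphere n K \<times> length_sphere n L)"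
    using g_eq carr by force
qed

lemma sphere_size_submult: "sphere_size n (K + L) \<le> sphere_size n K * sphere_size n L"
proof -
  have "sphere_size n (K + L)
      \<le> card ((\<lambda>(g, h). g \<otimes>\<^bsub>locally_free_group n\<^esub> h) ` (length_sphere n K \<times> length_sphere n L))"
    unfolding sphere_size_def by (intro card_mono sphere_add_subset finite_imageI) (simp add: finite_length_sphere)
  also have "\<dots> \<le> card (length_sphere n K \<times> length_sphere n L)"
    by (rule card_image_le) (simp add: finite_length_sphere)
  finally show ?thesis by (simp add: sphere_size_def card_cartesian_product)
qed

text \<open>Powers of the first generator have every length. This makes the logarithms of the sphere
  sizes nonnegative.\<close>

lemma sphere_size_pos:
  assumes "n \<ge> 1"
  shows "sphere_size n K \<ge> 1"
proof -
  have "\<exists>p. normal_word n (replicate K (1, True)) p \<and> top_sign p 1 \<noteq> Some False"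
  proof (induction K)
    case 0
    then show ?case using normal_word.Nil[of n] by (auto intro!: exI[of _ "\<lambda>_. []"] simp: top_sign_def)
  next
    case (Suc K)
    then obtain p where p: "normal_word n (replicate K (1, True)) p" "top_sign p 1 \<noteq> Some False"
      by blast
    then have "normal_word n (replicate K (1, True) @ [(1, True)]) (push (1, True) p)"
      using assms by (intro normal_word.snoc) auto
    then show ?case by (auto simp: replicate_append_same top_sign_push)
  qed
  then obtain p where "normal_word n (replicate K (1, True)) p" by blast
  then have "p \<in> {p \<in> pilings n. piling_size n p = K}"
    by (auto simp: pilings_def piling_size_normal_word)
  moreover have "finite {p \<in> pilings n. piling_size n p = K}"
    by (rule finite_subset[OF _ finite_pilings_piling_size[of n K]]) auto
  ultimately have "card {p \<in> pilings n. piling_size n p = K} > 0"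
    unfolding card_gt_0_iff by blast
  then show ?thesis by (simp add: sphere_size_pilings)
qed

lemma log_volume_LIMSEQ:
  assumes "n \<ge> 1"
  shows "(\<lambda>K. ln (real (sphere_size n K)) / real K) \<longlonglongrightarrow> log_volume n"
proof -
  have "convergent (\<lambda>K. ln (real (sphere_size n K)) / real K)"
  proof (rule subadditive_convergent)
    fix K L
    have "real (sphere_size n (K + L)) \<le> real (sphere_size n K) * real (sphere_size n L)"
      using sphere_size_submult by (metis of_nat_le_iff of_nat_mult)
    then have "ln (real (sphere_size n (K + L))) \<le> ln (real (sphere_size n K) * real (sphere_size n L))"
      using sphere_size_pos[OF assms, of "K + L"] by (intro ln_mono) auto
    also have "\<dots> = ln (real (sphere_size n K)) + ln (real (sphere_size n L))"
      using sphere_size_pos[OF assms, of K] sphere_size_pos[OF assms, of L] by (simp add: ln_mult)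
    finally show "ln (real (sphere_size n (K + L))) \<le> \<dots>" .
  qed (use sphere_size_pos[OF assms] in simp)
  then show ?thesis unfolding log_volume_def by (simp add: convergent_LIMSEQ_iff)
qed

section \<open>The growth series and the lower bound on the volume\<close>

lemma from_sum_const: "from_sum (\<lambda>_. t) n 0 K = (\<Sum>k\<le>K. real (sphere_size n k) * t ^ k)"
proof -
  have "from_sum (\<lambda>_. t) n 0 K = (\<Sum>p\<in>{p \<in> pilings n. piling_size n p \<le> K}. t ^ piling_size n p)"
    by (simp add: from_sum_def pilings_from_def weight_const)
  also have "\<dots> = (\<Sum>k\<in>{..K}. \<Sum>p\<in>{p \<in> {p \<in> pilings n. piling_size n p \<le> K}. piling_size n p = k}. t ^ piling_size n p)"
    by (rule sum.group[symmetric]) (auto simp: finite_pilings_piling_size)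
  also have "\<dots> = (\<Sum>k\<le>K. real (sphere_size n k) * t ^ k)"
  proof (rule sum.cong)
    fix k assume "k \<in> {..K}"
    then have "{p \<in> {p \<in> pilings n. piling_size n p \<le> K}. piling_size n p = k} = {p \<in> pilings n. piling_size n p = k}"
      by auto
    then show "(\<Sum>p\<in>{p \<in> {p \<in> pilings n. piling_size n p \<le> K}. piling_size n p = k}. t ^ piling_size n p)
        = real (sphere_size n k) * t ^ k"
      by (simp add: sphere_size_pilings)
  qed simp
  finally show ?thesis .
qed

text \<open>Otherwise the growth series at \<open>t\<close> is eventually dominated by a geometric
  series of ratio \<open>r < 1\<close>, so its partial sums are bounded, against
  \<open>from_sum_unbounded\<close>.\<close>

lemma log_volume_ge:
  assumes n: "n \<ge> 2" and t: "0 < t" "2 * t / (1 + t) = 1 / (4 * cos (pi / (n + 1)) ^ 2)"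
  shows "log_volume n \<ge> - ln t"
proof (rule ccontr)
  assume "\<not> log_volume n \<ge> - ln t"
  then obtain c where c: "log_volume n < c" "c < - ln t" using dense by (metis not_le)
  define r where "r = exp (c + ln t)"
  have r: "0 < r" "r < 1" using c by (auto simp: r_def)
  have "(\<lambda>K. ln (real (sphere_size n K)) / real K) \<longlonglongrightarrow> log_volume n"
    using n by (intro log_volume_LIMSEQ) auto
  then have "\<forall>\<^sub>F K in sequentially. ln (real (sphere_size n K)) / real K < c"
    using c(1) by (rule order_tendstoD)
  then obtain N where N: "\<And>K. K \<ge> N \<Longrightarrow> ln (real (sphere_size n K)) / real K < c"
    by (auto simp: eventually_sequentially)
  have "summable (\<lambda>k. real (sphere_size n k) * t ^ k)"
  proof (rule summable_comparison_test[OF _ summable_geometric[of r]])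
    show "\<exists>N. \<forall>k\<ge>N. norm (real (sphere_size n k) * t ^ k) \<le> r ^ k"
    proof (intro exI allI impI)
      fix k assume k: "k \<ge> Suc N"
      have "ln (real (sphere_size n k)) < c * real k"
        using N[of k] k by (simp add: pos_divide_less_eq)
      moreover have pos: "real (sphere_size n k) > 0" using sphere_size_pos[of n k] n by simp
      ultimately have "real (sphere_size n k) < exp (c * real k)"
        by (metis exp_less_mono exp_ln)
      moreover have "t ^ k = exp (ln t * real k)"
        using t by (simp add: exp_of_nat2_mult)
      ultimately have "real (sphere_size n k) * t ^ k \<le> exp (c * real k) * exp (ln t * real k)"
        by (intro mult_mono) auto
      also have "\<dots> = r ^ k" by (simp add: r_def exp_of_nat2_mult[symmetric] exp_add[symmetric] distrib_right)
      finally show "norm (real (sphere_size n k) * t ^ k) \<le> r ^ k" using pos t by simp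
    qed
  qed (use r in auto)
  then have "from_sum (\<lambda>_. t) n 0 K \<le> (\<Sum>k. real (sphere_size n k) * t ^ k)" for K
    unfolding from_sum_const using t by (intro sum_le_suminf) auto
  then show False using from_sum_unbounded[OF n t] by blast
qed

subsection \<open>Entropy of finitely supported laws\<close>

lemma expectation_finite:
  fixes f :: "'a \<Rightarrow> real"
  assumes "finite (set_pmf p)"
  shows "measure_pmf.expectation p f = (\<Sum>x\<in>set_pmf p. pmf p x * f x)"
  by (subst integral_measure_pmf_real[OF assms]) (simp_all add: mult.commute)

lemma expectation_finite_mono:
  fixes f g :: "'a \<Rightarrow> real"
  assumes "finite (set_pmf p)" "\<And>x. x \<in> set_pmf p \<Longrightarrow> f x \<le> g x"
  shows "measure_pmf.expectation p f \<le> measure_pmf.expectation p g"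
  unfolding expectation_finite[OF assms(1)] using assms(2) by (intro sum_mono mult_left_mono) auto

lemma expectation_finite_cong:
  fixes f g :: "'a \<Rightarrow> real"
  assumes "\<And>x. x \<in> set_pmf p \<Longrightarrow> f x = g x"
  shows "measure_pmf.expectation p f = measure_pmf.expectation p g"
  using assms by (intro integral_cong_AE) (auto simp: AE_measure_pmf_iff)

lemma shannon_entropy_expectation:
  assumes "finite (set_pmf p)"
  shows "shannon_entropy p = measure_pmf.expectation p (\<lambda>x. - ln (pmf p x))"
  by (simp add: expectation_finite[OF assms] shannon_entropy_def sum_negf)

lemma shannon_entropy_nonneg: "0 \<le> shannon_entropy p"
proof -
  have "pmf p x * ln (pmf p x) \<le> 0" if "x \<in> set_pmf p" for x
    using that by (intro mult_nonneg_nonpos) (auto simp: pmf_le_1 pmf_positive)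
  then show ?thesis unfolding shannon_entropy_def by (simp add: sum_nonpos)
qed

text \<open>A point has at most the mass of its fibre under \<open>f\<close>, so its surprisal can
  only drop.\<close>

lemma shannon_entropy_map_le:
  assumes "finite (set_pmf p)"
  shows "shannon_entropy (map_pmf f p) \<le> shannon_entropy p"
proof -
  have "measure_pmf.prob p {x} \<le> measure_pmf.prob p (f -` {f x})" for x
    by (intro measure_pmf.finite_measure_mono) auto
  then have "pmf p x \<le> pmf (map_pmf f p) (f x)" for x
    by (simp add: pmf_map measure_pmf_single)
  then have "measure_pmf.expectation p (\<lambda>x. - ln (pmf (map_pmf f p) (f x)))
      \<le> measure_pmf.expectation p (\<lambda>x. - ln (pmf p x))"
    by (intro expectation_finite_mono assms) (simp add: pmf_positive)
  then show ?thesis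
    using assms by (simp add: shannon_entropy_expectation)
qed

lemma shannon_entropy_pair:
  assumes "finite (set_pmf p)" "finite (set_pmf q)"
  shows "shannon_entropy (pair_pmf p q) = shannon_entropy p + shannon_entropy q"
proof -
  let ?E = "measure_pmf.expectation (pair_pmf p q)"
  have fin: "finite (set_pmf (pair_pmf p q))" using assms by simp
  have int: "integrable (pair_pmf p q) f" for f :: "_ \<Rightarrow> real"
    using fin by (rule integrable_measure_pmf_finite)
  have "shannon_entropy (pair_pmf p q)
      = ?E (\<lambda>z. - ln (pmf p (fst z)) + - ln (pmf q (snd z)))"
    unfolding shannon_entropy_expectation[OF fin]
  proof (rule expectation_finite_cong)
    fix z assume "z \<in> set_pmf (pair_pmf p q)"
    then have "0 < pmf p (fst z)" "0 < pmf q (snd z)" by (auto intro: pmf_positive)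
    then show "- ln (pmf (pair_pmf p q) z) = - ln (pmf p (fst z)) + - ln (pmf q (snd z))"
      by (cases z) (simp add: pmf_pair ln_mult)
  qed
  also have "\<dots> = ?E (\<lambda>z. - ln (pmf p (fst z))) + ?E (\<lambda>z. - ln (pmf q (snd z)))"
    by (rule Bochner_Integration.integral_add[OF int int])
  also have "?E (\<lambda>z. - ln (pmf p (fst z)))
      = measure_pmf.expectation (map_pmf fst (pair_pmf p q)) (\<lambda>x. - ln (pmf p x))"
    by simp
  also have "?E (\<lambda>z. - ln (pmf q (snd z)))
      = measure_pmf.expectation (map_pmf snd (pair_pmf p q)) (\<lambda>x. - ln (pmf q x))"
    by simp
  finally show ?thesis
    using assms by (simp add: map_fst_pair_pmf map_snd_pair_pmf shannon_entropy_expectation)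
qed

text \<open>Gibbs' inequality for an unnormalized weight of total mass at most \<open>Z\<close>,
  from \<open>ln y \<le> y - 1\<close> at \<open>y = q x / (Z * pmf p x)\<close>.\<close>

lemma shannon_entropy_le_cross_entropy:
  assumes fin: "finite (set_pmf p)" and q: "\<And>x. x \<in> set_pmf p \<Longrightarrow> 0 < q x"
    and Z: "sum q (set_pmf p) \<le> Z"
  shows "shannon_entropy p \<le> measure_pmf.expectation p (\<lambda>x. - ln (q x)) + ln Z"
proof -
  have "0 < sum q (set_pmf p)"
    using fin q by (intro sum_pos) (auto simp: set_pmf_not_empty)
  then have Z0: "0 < Z" using Z by linarith
  have one: "sum (pmf p) (set_pmf p) = 1" using fin by (rule sum_pmf_eq_1) simp
  have "- (pmf p x * ln (pmf p x)) \<le> pmf p x * (- ln (q x)) + pmf p x * ln Z + (q x / Z - pmf p x)"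
    if x: "x \<in> set_pmf p" for x
  proof -
    have P: "0 < pmf p x" using x by (rule pmf_positive)
    have "ln (q x / (Z * pmf p x)) \<le> q x / (Z * pmf p x) - 1"
      using P q[OF x] Z0 by (intro ln_le_minus_one) simp
    moreover have "ln (q x / (Z * pmf p x)) = ln (q x) - ln Z - ln (pmf p x)"
      using P q[OF x] Z0 by (simp add: ln_div ln_mult)
    ultimately have "pmf p x * (ln (q x) - ln Z - ln (pmf p x)) \<le> pmf p x * (q x / (Z * pmf p x) - 1)"
      using P by (intro mult_left_mono) auto
    also have "\<dots> = q x / Z - pmf p x" using P Z0 by (simp add: field_simps)
    finally show ?thesis by (simp add: algebra_simps)
  qed
  then have "shannon_entropy p
      \<le> (\<Sum>x\<in>set_pmf p. pmf p x * (- ln (q x)) + pmf p x * ln Z + (q x / Z - pmf p x))"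
    unfolding shannon_entropy_def sum_negf[symmetric] by (rule sum_mono)
  also have "\<dots> = measure_pmf.expectation p (\<lambda>x. - ln (q x)) + ln Z + (sum q (set_pmf p) / Z - 1)"
    unfolding expectation_finite[OF fin]
    by (simp only: sum.distrib sum_subtractf sum_divide_distrib[symmetric] sum_distrib_right[symmetric] one mult_1)
  also have "sum q (set_pmf p) / Z \<le> 1" using Z Z0 by simp
  finally show ?thesis by simp
qed

subsection \<open>The random walk on pilings\<close>

definition letters :: "nat \<Rightarrow> nat letter set" where
  "letters n = {1..n} \<times> UNIV"

lemma finite_letters [simp]: "finite (letters n)"
  by (simp add: letters_def)

lemma card_letters: "card (letters n) = 2 * n"
  by (simp add: letters_def card_cartesian_product)

lemma in_letters_iff: "a \<in> letters n \<longleftrightarrow> fst a \<in> {1..n}"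
  by (cases a) (simp add: letters_def)

lemma letters_nonempty: "n \<ge> 1 \<Longrightarrow> letters n \<noteq> {}"
  using card_letters[of n] by fastforce

lemma step_law_letters: "step_law n = map_pmf (\<lambda>a. lf_elem n [a]) (pmf_of_set (letters n))"
  by (simp add: step_law_def letters_def)

lemma set_walk_law:
  assumes n: "n \<ge> 1"
  shows "set_pmf (walk_law n N) \<subseteq> lf_elem n ` {w \<in> words {1..n}. length w = N}"
proof (induction N)
  case 0
  then show ?case by (auto simp: locally_free_group_def presented_group_def)
next
  case (Suc N)
  show ?case
  proof
    fix x assume "x \<in> set_pmf (walk_law n (Suc N))"
    then obtain g a where "g \<in> set_pmf (walk_law n N)" "a \<in> letters n"
      "x = g \<otimes>\<^bsub>locally_free_group n\<^esub> lf_elem n [a]"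
      using letters_nonempty[OF n] by (auto simp: step_law_letters)
    moreover from this(1) obtain w where "w \<in> words {1..n}" "length w = N" "g = lf_elem n w"
      using Suc by blast
    ultimately have "x = lf_elem n (w @ [a])" "w @ [a] \<in> words {1..n}" "length (w @ [a]) = Suc N"
      by (auto simp: lf_elem_mult in_letters_iff)
    then show "x \<in> lf_elem n ` {w \<in> words {1..n}. length w = Suc N}" by blast
  qed
qed

lemma set_walk_law_carrier: "n \<ge> 1 \<Longrightarrow> set_pmf (walk_law n N) \<subseteq> carrier (locally_free_group n)"
  using set_walk_law by (fastforce simp: carrier_locally_free_group)

lemma finite_set_walk_law:
  assumes "n \<ge> 1"
  shows "finite (set_pmf (walk_law n N))"
proof (rule finite_subset[OF set_walk_law[OF assms]])
  have "{w \<in> words {1..n}. length w = N} = {w. set w \<subseteq> {1..n} \<times> UNIV \<and> length w = N}"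
    by (auto simp: words_def lists_eq_set)
  then show "finite (lf_elem n ` {w \<in> words {1..n}. length w = N})"
    by (simp add: finite_lists_length_eq)
qed

lemma piling_of_elem_mult:
  assumes "g \<in> carrier (locally_free_group n)" "a \<in> letters n"
  shows "piling_of_elem (g \<otimes>\<^bsub>locally_free_group n\<^esub> lf_elem n [a]) = act a (piling_of_elem g)"
proof -
  obtain w where w: "w \<in> words {1..n}" "g = lf_elem n w"
    using assms(1) by (auto simp: carrier_locally_free_group)
  have a: "[a] \<in> words {1..n}" using assms(2) by (simp add: in_letters_iff)
  then have "w @ [a] \<in> words {1..n}" using w by simp
  then show ?thesis using w a by (simp only: lf_elem_mult piling_of_elem piling_of_snoc)
qed

definition walk_mean :: "nat \<Rightarrow> nat \<Rightarrow> (piling \<Rightarrow> real) \<Rightarrow> real" where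
  "walk_mean n N f = measure_pmf.expectation (walk_law n N) (\<lambda>g. f (piling_of_elem g))"

lemma walk_mean_mono:
  assumes n: "n \<ge> 1" and le: "\<And>p. p \<in> pilings n \<Longrightarrow> f p \<le> g p"
  shows "walk_mean n N f \<le> walk_mean n N g"
  unfolding walk_mean_def
proof (rule expectation_finite_mono[OF finite_set_walk_law[OF n]])
  fix x assume "x \<in> set_pmf (walk_law n N)"
  then have "piling_of_elem x \<in> pilings n"
    using set_walk_law_carrier[OF n] bij_betw_piling_of_elem[of n] by (auto simp: bij_betw_def)
  then show "f (piling_of_elem x) \<le> g (piling_of_elem x)" by (rule le)
qed

lemma walk_mean_cong:
  assumes n: "n \<ge> 1" and eq: "\<And>p. p \<in> pilings n \<Longrightarrow> f p = g p"
  shows "walk_mean n N f = walk_mean n N g"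
  using walk_mean_mono[OF n, of f g N] walk_mean_mono[OF n, of g f N] eq by simp

lemma walk_mean_affine:
  assumes n: "n \<ge> 1"
  shows "walk_mean n N (\<lambda>p. c + a * f p + b * g p) = c + a * walk_mean n N f + b * walk_mean n N g"
proof -
  have "integrable (walk_law n N) f" for f :: "_ \<Rightarrow> real"
    using finite_set_walk_law[OF n] by (rule integrable_measure_pmf_finite)
  then show ?thesis by (simp add: walk_mean_def)
qed

text \<open>Reduces one step of the walk to a pointwise average over the \<open>2 * n\<close>
  letters, so that means can be bounded by induction on \<open>N\<close>.\<close>

lemma walk_mean_Suc:
  assumes n: "n \<ge> 1"
  shows "walk_mean n (Suc N) f = walk_mean n N (\<lambda>p. (\<Sum>a\<in>letters n. f (act a p)) / (2 * n))"
proof -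
  have "walk_mean n (Suc N) f = (\<Sum>g\<in>set_pmf (walk_law n N). pmf (walk_law n N) g *
      measure_pmf.expectation (step_law n)
        (\<lambda>s. f (piling_of_elem (g \<otimes>\<^bsub>locally_free_group n\<^esub> s))))"
    unfolding walk_mean_def walk_law.simps
    by (subst pmf_expectation_bind[OF finite_set_walk_law[OF n, of N]])
      (use letters_nonempty[OF n] in \<open>auto simp: step_law_letters\<close>)
  also have "\<dots> = (\<Sum>g\<in>set_pmf (walk_law n N). pmf (walk_law n N) g *
      ((\<Sum>a\<in>letters n. f (act a (piling_of_elem g))) / (2 * n)))"
  proof (rule sum.cong)
    fix g assume "g \<in> set_pmf (walk_law n N)"
    then have g: "g \<in> carrier (locally_free_group n)" using set_walk_law_carrier[OF n] by auto
    have "measure_pmf.expectation (step_law n) (\<lambda>s. f (piling_of_elem (g \<otimes>\<^bsub>locally_free_group n\<^esub> s)))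
      = (\<Sum>a\<in>letters n. f (piling_of_elem (g \<otimes>\<^bsub>locally_free_group n\<^esub> lf_elem n [a]))) / card (letters n)"
      unfolding step_law_letters using letters_nonempty[OF n] by (simp add: integral_pmf_of_set)
    also have "\<dots> = (\<Sum>a\<in>letters n. f (act a (piling_of_elem g))) / (2 * n)"
      using g by (simp add: piling_of_elem_mult card_letters)
    finally show "pmf (walk_law n N) g * measure_pmf.expectation (step_law n)
        (\<lambda>s. f (piling_of_elem (g \<otimes>\<^bsub>locally_free_group n\<^esub> s)))
      = pmf (walk_law n N) g * ((\<Sum>a\<in>letters n. f (act a (piling_of_elem g))) / (2 * n))"
      by simp
  qed simp
  finally show ?thesis
    unfolding walk_mean_def expectation_finite[OF finite_set_walk_law[OF n]] .
qed

section \<open>Occurrences of the first generator along the walk\<close>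

definition first_on_top :: "piling \<Rightarrow> real" where
  "first_on_top p = (if top_sign p 1 = None then 0 else 1)"

lemma top_sign_act_far:
  assumes "p \<in> pilings n" "fst a \<noteq> i" "\<not> near (fst a) i"
  shows "top_sign (act a p) i = top_sign p i"
  using assms by (auto simp: act_def top_sign_push pop_def push_def top_sign_def)

text \<open>If column 1 shows no sign, only its own two letters and the one letter cancelling a sign
  on column 2 can make it show one. If it shows a sign, both letters of column 2 hide it, which
  leaves \<open>2 * n - 2\<close> letters.\<close>

lemma sum_first_on_top_act:
  assumes n: "n \<ge> 2" and p: "p \<in> pilings n"
  shows "(\<Sum>a\<in>letters n. first_on_top (act a p)) \<le> 3 + (2 * real n - 5) * first_on_top p"
proof (cases "top_sign p 1 = None")
  case True
  define S where "S = {(1::nat, True), (1, False)} \<union> {(2::nat, e) | e. top_sign p 2 = Some (\<not> e)}"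
  \<comment> \<open>The last entry is the letter cancelling the sign on column 2 if there is one,
    and a harmless extra letter otherwise.\<close>
  have S: "S \<subseteq> {(1, True), (1, False), (2, top_sign p 2 = Some False)}"
    by (auto simp: S_def)
  have "first_on_top (act a p) = 0" if a: "a \<in> letters n - S" for a
  proof -
    have "fst a \<noteq> 1" using a by (cases a) (auto simp: S_def)
    moreover have "top_sign p 2 \<noteq> Some (\<not> snd a)" if "fst a = 2"
      using a that by (cases a) (auto simp: S_def)
    ultimately have "top_sign (act a p) 1 = None"
    proof (cases "fst a = 2")
      case True
      then show ?thesis using \<open>fst a = 2 \<Longrightarrow> top_sign p 2 \<noteq> Some (\<not> snd a)\<close>
        by (simp add: act_def top_sign_push near_def)
    next
      case False
      then have "\<not> near (fst a) 1" using a \<open>fst a \<noteq> 1\<close> by (auto simp: near_def in_letters_iff)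
      then show ?thesis using top_sign_act_far[OF p \<open>fst a \<noteq> 1\<close>] True \<open>top_sign p 1 = None\<close> by simp
    qed
    then show ?thesis by (simp add: first_on_top_def)
  qed
  then have "(\<Sum>a\<in>letters n. first_on_top (act a p)) = (\<Sum>a\<in>letters n \<inter> S. first_on_top (act a p))"
    by (intro sum.mono_neutral_right) auto
  also have "\<dots> \<le> (\<Sum>a\<in>letters n \<inter> S. 1)"
    by (intro sum_mono) (simp add: first_on_top_def)
  also have "\<dots> \<le> 3"
  proof -
    have "card (letters n \<inter> S) \<le> card {(1::nat, True), (1, False), (2, top_sign p 2 = Some False)}"
      using S by (intro card_mono) auto
    then show ?thesis by simp
  qed
  finally show ?thesis using True by (simp add: first_on_top_def)
next
  case False
  then obtain e where e: "top_sign p 1 = Some e" by auto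
  \<comment> \<open>Hence no letter of column 2 cancels; each is pushed and covers column 1.\<close>
  have t2: "top_sign p 2 = None" using top_sign_near[OF p e] by (simp add: near_def)
  let ?S = "{(2::nat, True), (2, False)}"
  have "(\<Sum>a\<in>letters n. first_on_top (act a p)) = (\<Sum>a\<in>letters n - ?S. first_on_top (act a p))"
  proof (intro sum.mono_neutral_right ballI)
    fix a assume "a \<in> letters n - (letters n - ?S)"
    then have "fst a = 2" by auto
    then show "first_on_top (act a p) = 0"
      using t2 by (simp add: act_def top_sign_push near_def first_on_top_def)
  qed auto
  also have "\<dots> \<le> (\<Sum>a\<in>letters n - ?S. 1)"
    by (intro sum_mono) (simp add: first_on_top_def)
  also have "\<dots> = 2 * real n - 2"
  proof -
    have "?S \<subseteq> letters n" using n by (auto simp: in_letters_iff)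
    then have "card (letters n - ?S) = 2 * n - 2"
      by (subst card_Diff_subset) (auto simp: card_letters)
    then show ?thesis using n by simp
  qed
  finally show ?thesis using e by (simp add: first_on_top_def[of p])
qed

text \<open>A step covers a visible letter of column 1 with probability at least \<open>1 / n\<close>, and uncovers or
  creates one with probability at most \<open>3 / (2 * n)\<close>; the two balance at \<open>3 / 5\<close>.\<close>

lemma walk_mean_first_on_top:
  assumes n: "n \<ge> 3"
  shows "walk_mean n N first_on_top \<le> 3 / 5"
proof (induction N)
  case 0
  have "piling_of_elem \<one>\<^bsub>locally_free_group n\<^esub> = (\<lambda>_. [])"
    using piling_of_elem[of "[]" n] by (simp add: locally_free_group_def presented_group_def)
  then show ?case by (simp add: walk_mean_def first_on_top_def top_sign_def)
next
  case (Suc N)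
  have "walk_mean n (Suc N) first_on_top
      \<le> walk_mean n N (\<lambda>p. 3 / (2 * n) + (2 * real n - 5) / (2 * n) * first_on_top p + 0 * first_on_top p)"
    using n sum_first_on_top_act[of n]
    by (subst walk_mean_Suc) (auto intro!: walk_mean_mono simp: add_divide_distrib[symmetric] divide_right_mono)
  also have "\<dots> = 3 / (2 * n) + (2 * real n - 5) / (2 * n) * walk_mean n N first_on_top"
    using n by (subst walk_mean_affine) auto
  \<comment> \<open>Here \<open>n \<ge> 3\<close> makes the factor \<open>2 * n - 5\<close>
    nonnegative.\<close>
  also have "\<dots> \<le> 3 / (2 * n) + (2 * real n - 5) / (2 * n) * (3 / 5)"
    using n Suc by (intro add_left_mono mult_left_mono) auto
  also have "\<dots> = 3 / 5" using n by (simp add: field_simps)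
  finally show ?case .
qed

lemma occ_act:
  assumes p: "p \<in> pilings n"
  shows "real (occ (act a p) i) = real (occ p i) +
    (if i = fst a then if top_sign p (fst a) = Some (\<not> snd a) then -1 else 1 else 0)"
proof (cases "top_sign p (fst a) = Some (\<not> snd a)")
  case True
  then obtain q where q: "p = push (fst a, \<not> snd a) q" using piling_cases[OF p] by metis
  then have "act a p = q" using True pop_push[of "(fst a, \<not> snd a)" q] by (simp add: act_def)
  then show ?thesis using True by (simp add: q occ_push)
next
  case False
  then show ?thesis by (simp add: act_def occ_push)
qed

text \<open>Only the two letters of column 1 matter: both add an occurrence if the column shows no
  sign; otherwise one adds and one removes.\<close>

lemma sum_occ_act:
  assumes p: "p \<in> pilings n" and n: "n \<ge> 1"
  shows "(\<Sum>a\<in>letters n. real (occ (act a p) 1)) = 2 * real n * occ p 1 + 2 - 2 * first_on_top p"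
proof -
  let ?d = "\<lambda>a. if 1 = fst a then if top_sign p (fst a) = Some (\<not> snd a) then -1 else 1 else (0::real)"
  have "(\<Sum>a\<in>letters n. ?d a) = (\<Sum>a\<in>{(1, True), (1, False)}. ?d a)"
    using n by (intro sum.mono_neutral_right) (auto simp: in_letters_iff)
  also have "\<dots> = 2 - 2 * first_on_top p"
    by (cases "top_sign p 1") (auto simp: first_on_top_def)
  finally show ?thesis using occ_act[OF p, of _ 1] by (simp add: sum.distrib card_letters)
qed

text \<open>Each step adds \<open>1 / n\<close> times the probability that column 1 shows no sign,
  which is at least \<open>2 / 5\<close> by \<open>walk_mean_first_on_top\<close>.\<close>

lemma walk_mean_occ:
  assumes n: "n \<ge> 3"
  shows "walk_mean n N (\<lambda>p. occ p 1) \<ge> 2 * real N / (5 * real n)"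
proof (induction N)
  case 0
  have "0 \<le> walk_mean n 0 (\<lambda>p. occ p 1)" unfolding walk_mean_def by (rule Bochner_Integration.integral_nonneg) simp
  then show ?case by simp
next
  case (Suc N)
  have "walk_mean n (Suc N) (\<lambda>p. occ p 1)
      = walk_mean n N (\<lambda>p. 1 / n + 1 * real (occ p 1) + (- 1 / n) * first_on_top p)"
    using n by (subst walk_mean_Suc) (auto intro!: walk_mean_cong simp: sum_occ_act field_simps)
  also have "\<dots> = 1 / n + 1 * walk_mean n N (\<lambda>p. occ p 1) + (- 1 / n) * walk_mean n N first_on_top"
    using n by (intro walk_mean_affine) auto
  also have "\<dots> \<ge> 1 / n + 2 * real N / (5 * real n) + (- 1 / n) * (3 / 5)"
    using n Suc walk_mean_first_on_top[OF n, of N]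
    by (intro add_mono mult_left_mono_neg) auto
  also have "1 / n + 2 * real N / (5 * real n) + (- 1 / n) * (3 / 5) = 2 * real (Suc N) / (5 * real n)"
    using n by (simp add: field_simps)
  finally show ?case .
qed

section \<open>Expected length and existence of the entropy\<close>

lemma expected_length_walk_mean:
  assumes n: "n \<ge> 1"
  shows "expected_length n N = walk_mean n N (\<lambda>p. piling_size n p)"
  unfolding expected_length_def walk_mean_def
  using set_walk_law_carrier[OF n, THEN subsetD]
  by (intro expectation_finite_cong) (simp add: lf_length_eq_piling_size)

lemma lf_length_walk:
  assumes "n \<ge> 1" "g \<in> set_pmf (walk_law n N)"
  shows "lf_length n g \<le> N"
  using set_walk_law[OF assms(1), of N] assms(2) lf_length_le by force

lemma expected_length_bounds:
  assumes n: "n \<ge> 1"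
  shows "0 \<le> expected_length n N" "expected_length n N \<le> N"
proof -
  show "0 \<le> expected_length n N" unfolding expected_length_def by (rule Bochner_Integration.integral_nonneg) simp
  have "expected_length n N \<le> measure_pmf.expectation (walk_law n N) (\<lambda>_. real N)"
    unfolding expected_length_def
    using lf_length_walk[OF n] by (intro expectation_finite_mono finite_set_walk_law[OF n]) simp
  then show "expected_length n N \<le> N" by simp
qed

text \<open>By associativity the last \<open>N\<close> steps form an independent walk from the
  identity. As images have no larger entropy, this makes the entropy subadditive.\<close>

lemma walk_law_add:
  assumes n: "n \<ge> 1"
  shows "walk_law n (M + N) =
    map_pmf (\<lambda>(g, h). g \<otimes>\<^bsub>locally_free_group n\<^esub> h) (pair_pmf (walk_law n M) (walk_law n N))"
proof -
  let ?G = "locally_free_group n"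
  interpret G: group ?G unfolding locally_free_group_def by (rule group_presented_group)
  note carr = set_walk_law_carrier[OF n, THEN subsetD]
  have step: "s \<in> carrier ?G" if "s \<in> set_pmf (step_law n)" for s
    using that letters_nonempty[OF n]
    by (auto simp: step_law_letters carrier_locally_free_group in_letters_iff)
  have "walk_law n (M + N) = bind_pmf (walk_law n M) (\<lambda>g. map_pmf (\<lambda>h. g \<otimes>\<^bsub>?G\<^esub> h) (walk_law n N))"
  proof (induction N)
    case 0
    have "bind_pmf (walk_law n M) (\<lambda>g. map_pmf (\<lambda>h. g \<otimes>\<^bsub>?G\<^esub> h) (walk_law n 0))
        = bind_pmf (walk_law n M) return_pmf"
      using carr by (intro bind_pmf_cong) simp_all
    then show ?case by (simp add: bind_return_pmf')
  next
    case (Suc N)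
    have "walk_law n (M + Suc N) = bind_pmf (walk_law n M) (\<lambda>g. bind_pmf (walk_law n N)
        (\<lambda>h. map_pmf (\<lambda>s. (g \<otimes>\<^bsub>?G\<^esub> h) \<otimes>\<^bsub>?G\<^esub> s) (step_law n)))"
      by (simp add: Suc bind_assoc_pmf bind_map_pmf)
    also have "\<dots> = bind_pmf (walk_law n M) (\<lambda>g. bind_pmf (walk_law n N)
        (\<lambda>h. map_pmf (\<lambda>s. g \<otimes>\<^bsub>?G\<^esub> (h \<otimes>\<^bsub>?G\<^esub> s)) (step_law n)))"
      using carr step by (intro bind_pmf_cong map_pmf_cong refl) (auto simp: G.m_assoc)
    finally show ?case by (simp add: map_bind_pmf pmf.map_comp o_def)
  qed
  then show ?thesis by (simp add: pair_pmf_def map_bind_pmf map_pmf_def bind_assoc_pmf bind_return_pmf)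
qed

lemma walk_entropy_LIMSEQ:
  assumes n: "n \<ge> 1"
  shows "(\<lambda>N. shannon_entropy (walk_law n N) / real N) \<longlonglongrightarrow> walk_entropy n"
proof -
  have "convergent (\<lambda>N. shannon_entropy (walk_law n N) / real N)"
  proof (rule subadditive_convergent)
    fix M N
    note fin = finite_set_walk_law[OF n]
    show "shannon_entropy (walk_law n (M + N))
        \<le> shannon_entropy (walk_law n M) + shannon_entropy (walk_law n N)"
      using shannon_entropy_map_le[of "pair_pmf (walk_law n M) (walk_law n N)"] fin
      unfolding walk_law_add[OF n] by (simp add: shannon_entropy_pair)
  qed (rule shannon_entropy_nonneg)
  then show ?thesis unfolding walk_entropy_def by (simp add: convergent_LIMSEQ_iff)
qed

section \<open>The upper bound on the entropy\<close>

lemma crit_neq_0: "crit i \<noteq> 0"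
  by (simp add: crit_def)

lemma ln_weight_crit:
  assumes n: "n \<ge> 1"
  shows "ln (weight crit n p) = ln (7 / 3) * occ p 1 - ln 7 * piling_size n p"
proof -
  have "ln (weight crit n p) = (\<Sum>i\<in>{1..n}. real (occ p i) * ln (crit i))"
    unfolding weight_def using crit_pos
    by (subst ln_prod) (auto simp: ln_realpow crit_neq_0 intro!: sum.cong)
  \<comment> \<open>\<open>crit 1 = (7 / 3) * (1 / 7)\<close>: every letter costs
    \<open>ln 7\<close>, and one in column 1 gets back \<open>ln (7 / 3)\<close>.\<close>
  also have "\<dots> = (\<Sum>i\<in>{1..n}. (if i = 1 then ln (7 / 3) * real (occ p 1) else 0) - ln 7 * real (occ p i))"
    by (intro sum.cong) (auto simp: crit_def ln_div algebra_simps)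
  also have "\<dots> = ln (7 / 3) * occ p 1 - ln 7 * piling_size n p"
    using n by (simp add: sum_subtractf piling_size_def sum_distrib_left)
  finally show ?thesis .
qed

text \<open>Gibbs' inequality against \<open>weight crit\<close>, whose total over the support is at
  most \<open>2 ^ n\<close>. The resulting \<open>n * ln 2\<close> does not depend on
  \<open>N\<close> and disappears in the limit.\<close>

lemma shannon_entropy_walk_le:
  assumes n: "n \<ge> 3"
  shows "shannon_entropy (walk_law n N)
    \<le> ln 7 * expected_length n N - ln (7 / 3) * (2 * real N / (5 * real n)) + n * ln 2"
proof -
  have n1: "n \<ge> 1" using n by simp
  let ?q = "\<lambda>g. weight crit n (piling_of_elem g)"
  have inj: "inj_on piling_of_elem (set_pmf (walk_law n N))"
    using bij_betw_piling_of_elem[of n] set_walk_law_carrier[OF n1]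
    by (auto simp: bij_betw_def intro: inj_on_subset)
  have sub: "piling_of_elem ` set_pmf (walk_law n N) \<subseteq> {p \<in> pilings n. piling_size n p \<le> N}"
  proof (intro image_subsetI)
    fix g assume g: "g \<in> set_pmf (walk_law n N)"
    then have "g \<in> carrier (locally_free_group n)" using set_walk_law_carrier[OF n1] by auto
    then show "piling_of_elem g \<in> {p \<in> pilings n. piling_size n p \<le> N}"
      using lf_length_walk[OF n1 g] bij_betw_piling_of_elem[of n]
      by (auto simp: lf_length_eq_piling_size bij_betw_def)
  qed
  have "sum ?q (set_pmf (walk_law n N)) = sum (weight crit n) (piling_of_elem ` set_pmf (walk_law n N))"
    using inj by (simp add: sum.reindex)
  also have "\<dots> \<le> sum (weight crit n) {p \<in> pilings n. piling_size n p \<le> N}"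
    using sub less_imp_le[OF crit_pos] by (intro sum_mono2 weight_nonneg) (auto simp: finite_pilings_piling_size)
  also have "\<dots> \<le> 2 ^ n" by (rule sum_crit_weight_le)
  finally have "shannon_entropy (walk_law n N)
      \<le> measure_pmf.expectation (walk_law n N) (\<lambda>g. - ln (?q g)) + ln (2 ^ n)"
    using crit_pos
    by (intro shannon_entropy_le_cross_entropy finite_set_walk_law[OF n1])
      (auto simp: weight_def intro!: prod_pos)
  also have "measure_pmf.expectation (walk_law n N) (\<lambda>g. - ln (?q g))
      = walk_mean n N (\<lambda>p. 0 + ln 7 * real (piling_size n p) + (- ln (7 / 3)) * real (occ p 1))"
    unfolding walk_mean_def ln_weight_crit[OF n1] by simp
  also have "\<dots> = ln 7 * expected_length n N - ln (7 / 3) * walk_mean n N (\<lambda>p. occ p 1)"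
    unfolding walk_mean_affine[OF n1] by (simp add: expected_length_walk_mean n1)
  also have "ln (2 ^ n) = n * ln (2::real)" by (simp add: ln_realpow)
  also have "ln 7 * expected_length n N - ln (7 / 3) * walk_mean n N (\<lambda>p. occ p 1)
      \<le> ln 7 * expected_length n N - ln (7 / 3) * (2 * real N / (5 * real n))"
    using walk_mean_occ[OF n, of N] by (intro diff_left_mono mult_left_mono) auto
  finally show ?thesis by simp
qed

lemma drift_bounds:
  assumes n: "n \<ge> 1"
  shows "ereal (drift n) = limsup (\<lambda>N. ereal (expected_length n N / real N))"
    "0 \<le> drift n" "drift n \<le> 1"
proof -
  let ?l = "limsup (\<lambda>N. ereal (expected_length n N / real N))"
  have bounds: "0 \<le> expected_length n N / real N" "expected_length n N / real N \<le> 1" for N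
    using expected_length_bounds[OF n, of N] by (auto simp: divide_le_eq)
  have "0 \<le> ?l" by (intro le_Limsup) (use bounds(1) in \<open>auto\<close>)
  moreover have "?l \<le> 1" by (intro Limsup_bounded) (use bounds(2) in \<open>auto\<close>)
  ultimately show "ereal (drift n) = ?l" "0 \<le> drift n" "drift n \<le> 1"
    unfolding drift_def by (cases ?l; simp)+
qed

lemma walk_entropy_upper:
  assumes n: "n \<ge> 3"
  shows "walk_entropy n \<le> ln 7 * drift n - 2 * ln (7 / 3) / (5 * real n)"
proof -
  have n1: "n \<ge> 1" using n by simp
  \<comment> \<open>The bound of \<open>shannon_entropy_walk_le\<close> solved for
    \<open>expected_length n N / N\<close>. This lower bound converges, so comparing upper limits
    suffices.\<close>
  let ?a = "\<lambda>N. (shannon_entropy (walk_law n N) / real N + 2 * ln (7 / 3) / (5 * real n) - n * ln 2 * (1 / N)) / ln 7"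
  have "?a \<longlonglongrightarrow> (walk_entropy n + 2 * ln (7 / 3) / (5 * real n) - n * ln 2 * 0) / ln 7"
    by (intro tendsto_intros walk_entropy_LIMSEQ[OF n1] lim_1_over_n) simp
  then have "limsup (\<lambda>N. ereal (?a N)) = ereal ((walk_entropy n + 2 * ln (7 / 3) / (5 * real n)) / ln 7)"
    by (intro lim_imp_Limsup) simp_all
  then have "ereal ((walk_entropy n + 2 * ln (7 / 3) / (5 * real n)) / ln 7) = limsup (\<lambda>N. ereal (?a N))" ..
  also have "\<dots> \<le> limsup (\<lambda>N. ereal (expected_length n N / real N))"
  proof (rule Limsup_mono, rule eventually_sequentiallyI[of 1])
    fix N :: nat assume "1 \<le> N"
    have "shannon_entropy (walk_law n N) / N
        \<le> (ln 7 * expected_length n N - ln (7 / 3) * (2 * real N / (5 * real n)) + n * ln 2) / N"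
      by (intro divide_right_mono shannon_entropy_walk_le n) simp
    also have "\<dots> = ln 7 * (expected_length n N / N) - 2 * ln (7 / 3) / (5 * real n) + n * ln 2 * (1 / N)"
      using \<open>1 \<le> N\<close> n by (simp add: add_divide_distrib diff_divide_distrib)
    finally show "ereal (?a N) \<le> ereal (expected_length n N / real N)"
      by (simp add: pos_divide_le_eq mult.commute)
  qed
  also have "\<dots> = ereal (drift n)" using drift_bounds(1)[OF n1] ..
  finally have "(walk_entropy n + 2 * ln (7 / 3) / (5 * real n)) / ln 7 \<le> drift n" by simp
  then show ?thesis by (simp add: pos_divide_le_eq mult.commute)
qed

section \<open>Volume deficit against entropy gain\<close>

text \<open>The left side is of order \<open>1 / n\<close>. The right side is
  \<open>O(1 / n^2)\<close>, since the squared cosine is \<open>1 - O(1 / n^2)\<close>.\<close>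

lemma volume_deficit_less:
  "\<forall>\<^sub>F n in sequentially. 2 * ln (7 / 3) / (5 * real n) > ln 7 - ln (8 * cos (pi / (real n + 1)) ^ 2 - 1)"
  by real_asymp

text \<open>Keeps \<open>8 * cos (pi / (n + 1)) ^ 2 - 1\<close>, the argument of the logarithm, at
  least 3.\<close>

lemma cos_squared_ge_half:
  assumes n: "n \<ge> (3::nat)"
  shows "cos (pi / (real n + 1)) ^ 2 \<ge> 1 / 2"
proof -
  have "cos (pi / (real n + 1)) \<ge> cos (pi / 4)"
    using n by (intro cos_monotone_0_pi_le) (auto simp: field_simps)
  then have "cos (pi / (real n + 1)) ^ 2 \<ge> (sqrt 2 / 2) ^ 2"
    by (intro power_mono) (auto simp: cos_45)
  then show ?thesis by (simp add: power_divide)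
qed

lemma log_volume_lower:
  assumes n: "n \<ge> 3"
  shows "log_volume n \<ge> ln (8 * cos (pi / (real n + 1)) ^ 2 - 1)"
proof -
  define c where "c = cos (pi / (real n + 1)) ^ 2"
  have c: "c \<ge> 1 / 2" using cos_squared_ge_half[OF n] by (simp add: c_def)
  \<comment> \<open>Solves \<open>2 * t / (1 + t) = 1 / (4 * c)\<close>, as
    \<open>log_volume_ge\<close> requires.\<close>
  define t where "t = 1 / (8 * c - 1)"
  have "1 + t = 8 * c / (8 * c - 1)" "0 < t"
    using c by (auto simp: t_def field_simps)
  then have "2 * t / (1 + t) = 2 * t * ((8 * c - 1) / (8 * c))" by simp
  also have "\<dots> = 2 * (t * (8 * c - 1)) / (8 * c)" by simp
  also have "t * (8 * c - 1) = 1" using c by (simp add: t_def)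
  also have "2 * 1 / (8 * c) = 1 / (4 * c)" by simp
  finally have "log_volume n \<ge> - ln t"
    using n \<open>0 < t\<close> unfolding c_def by (intro log_volume_ge) auto
  then show ?thesis using c by (simp add: t_def ln_div c_def)
qed

theorem theorem7:
  "\<forall>\<^sub>F n in sequentially. log_volume n * drift n > walk_entropy n"
  using volume_deficit_less eventually_ge_at_top[of 3]
proof eventually_elim
  case (elim n)
  let ?v = "ln (8 * cos (pi / (real n + 1)) ^ 2 - 1)"
  have d: "0 \<le> drift n" "drift n \<le> 1" using elim by (auto intro: drift_bounds)
  have v: "?v \<le> log_volume n" using log_volume_lower[of n] elim by (simp add: add.commute)
  have "?v \<le> ln 7"
    using cos_squared_ge_half[of n] elim by (intro ln_mono) (auto simp: abs_square_le_1)
  \<comment> \<open>As the drift is at most 1, replacing \<open>ln 7\<close> by \<open>?v\<close>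
    costs at most the deficit \<open>ln 7 - ?v\<close>, which \<open>volume_deficit_less\<close>
    makes smaller than the entropy gain.\<close>
  then have "(ln 7 - ?v) * drift n \<le> (ln 7 - ?v) * 1" using d by (intro mult_left_mono) auto
  moreover have "?v * drift n \<le> log_volume n * drift n" using v d by (intro mult_right_mono)
  moreover have "walk_entropy n \<le> ln 7 * drift n - 2 * ln (7 / 3) / (5 * real n)"
    using elim by (intro walk_entropy_upper) auto
  ultimately show ?case using elim by (simp add: algebra_simps)
qed

end
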